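(* For every integer $k\geq 2$, the function $\mathcal{F}_k(z)=\mathcal{W}'_k(q)/\mathcal{W}_k(q)$ is a weight $2k$ holomorphic modular form on $\mathrm{SL}_2(\mathbb{Z})$.
   Context: Let $z$ be in the upper half-plane $\mathbb{H}$ and $q:=e^{2\pi i z}$; for rational $a$, $q^a:=e^{2\pi i a z}$. For an integer $k\ge 2$ put $c_k:=1-\frac{3(2k-1)^2}{2k+1}$, and for $1\le i\le k$ put $h_{i,k}:=\frac{(2(k-i)+1)^2-(2k-1)^2}{8(2k+1)}$ and $$\mathrm{ch}_{i,k}(q):=q^{h_{i,k}-\frac{c_k}{24}}\prod_{\substack{n\ge 1\\ n\not\equiv 0,\pm i\ (\mathrm{mod}\ 2k+1)}}\frac{1}{1-q^n}.$$ Differentiation is $\left(\sum a(n)q^n\right)':=\sum n\,a(n)q^n$ (exponents $n$ rational), i.e. $q\frac{d}{dq}=\frac{1}{2\pi i}\frac{d}{dz}$; $f^{(m)}$ denotes the $m$-th iterate. Define $$\mathcal{W}_k(q):=\alpha(k)\det\left(\mathrm{ch}_{i,k}^{(m)}\right)_{0\le m\le k-1,\ 1\le i\le k},\qquad \mathcal{W}'_k(q):=\beta(k)\det\left(\mathrm{ch}_{i,k}^{(m)}\right)_{1\le m\le k,\ 1\le i\le k},$$ where $m$ indexes rows and $i$ indexes columns. Here $\alpha(k)$ is the constant making the leading coefficient of the $q$-expansion of $\mathcal{W}_k$ equal to $1$; $\beta(k)$ is the nonzero constant making the leading coefficient of $\mathcal{W}'_k$ equal to $1$ if the second determinant is not identically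 zero, and $\mathcal{W}'_k=0$ if that determinant is identically zero. ($\mathcal{W}'_k$ is a name and is not the derivative of $\mathcal{W}_k$.) The zero function counts as a modular form of every weight. *)

theory Defs
  imports
    "HOL-Complex_Analysis.Complex_Analysis"
    "HOL-Number_Theory.Cong"
    "Jordan_Normal_Form.Determinant"
begin

definition upper_half_plane :: "complex set" (\<open>\<H>\<close>) where
  "\<H> = {z. Im z > 0}"

(* q^a for rational a.  A rational power of q is not a function of q, so all q-series
   are treated as functions of z. *)
definition qpow :: "rat \<Rightarrow> complex \<Rightarrow> complex" where
  "qpow a z = exp (2 * of_real pi * \<i> * of_rat a * z)"

(* f has on \<H> the q-expansion with coefficients a and rational exponents; the exponents have a
   common denominator N and are bounded below. *)
definition has_q_expansion :: "(complex \<Rightarrow> complex) \<Rightarrow> (rat \<Rightarrow> complex) \<Rightarrow> bool" where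
  "has_q_expansion f a \<longleftrightarrow>
     (\<exists>N::nat. \<exists>M::int. N > 0 \<and>
        (\<forall>x. a x \<noteq> 0 \<longrightarrow> (\<exists>j\<ge>M. x = of_int j / of_nat N))) \<and>
     (\<forall>z\<in>\<H>. ((\<lambda>x. a x * qpow x z) has_sum f z) UNIV)"

definition has_leading_coeff :: "(complex \<Rightarrow> complex) \<Rightarrow> complex \<Rightarrow> bool" where
  "has_leading_coeff f c \<longleftrightarrow>
     (\<exists>a x. has_q_expansion f a \<and> a x = c \<and> c \<noteq> 0 \<and> (\<forall>y<x. a y = 0))"

(* q d/dq = (1 / (2 pi i)) d/dz *)
definition qderiv :: "(complex \<Rightarrow> complex) \<Rightarrow> complex \<Rightarrow> complex" where
  "qderiv f z = deriv f z / (2 * of_real pi * \<i>)"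

definition central_charge :: "nat \<Rightarrow> rat" where
  "central_charge k = 1 - 3 * (2 * of_nat k - 1)^2 / (2 * of_nat k + 1)"

definition conf_weight :: "nat \<Rightarrow> nat \<Rightarrow> rat" where
  "conf_weight i k =
     ((2 * (of_nat k - of_nat i) + 1)^2 - (2 * of_nat k - 1)^2) / (8 * (2 * of_nat k + 1))"

definition ch :: "nat \<Rightarrow> nat \<Rightarrow> complex \<Rightarrow> complex" where
  "ch i k z =
     qpow (conf_weight i k - central_charge k / 24) z *
     (\<Prod>n. if n \<ge> 1 \<and> \<not> [int n = 0] (mod (2 * int k + 1))
                 \<and> \<not> [int n = int i] (mod (2 * int k + 1))
                 \<and> \<not> [int n = - int i] (mod (2 * int k + 1))
          then 1 / (1 - qpow (of_nat n) z) else 1)"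

(* Matrix indices start at 0, so column j belongs to ch (j + 1) k; the rows are the derivatives
   of order s, ..., s + k - 1. *)
definition wronskian_det :: "nat \<Rightarrow> nat \<Rightarrow> complex \<Rightarrow> complex" where
  "wronskian_det s k z =
     Determinant.det (Matrix.mat k k (\<lambda>(m, j). (qderiv ^^ (s + m)) (ch (j + 1) k) z))"

definition alpha :: "nat \<Rightarrow> complex" where
  "alpha k = (THE a. has_leading_coeff (\<lambda>z. a * wronskian_det 0 k z) 1)"

definition W :: "nat \<Rightarrow> complex \<Rightarrow> complex" where
  "W k z = alpha k * wronskian_det 0 k z"

(* Only meaningful if the determinant is not identically zero on \<H>. *)
definition beta :: "nat \<Rightarrow> complex" where
  "beta k = (THE b. has_leading_coeff (\<lambda>z. b * wronskian_det 1 k z) 1)"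

(* Not the derivative of W. *)
definition W' :: "nat \<Rightarrow> complex \<Rightarrow> complex" where
  "W' k z = (if \<forall>w\<in>\<H>. wronskian_det 1 k w = 0 then 0 else beta k * wronskian_det 1 k z)"

definition \<F> :: "nat \<Rightarrow> complex \<Rightarrow> complex" where
  "\<F> k z = W' k z / W k z"

(* Holomorphic modular forms on the full modular group SL(2,Z).  The last condition is
   holomorphy at the cusp: a q-expansion in nonnegative integral powers of q. *)
definition holomorphic_modular_form :: "int \<Rightarrow> (complex \<Rightarrow> complex) \<Rightarrow> bool" where
  "holomorphic_modular_form w f \<longleftrightarrow>
     f holomorphic_on \<H> \<and>
     (\<forall>a b c d :: int. a * d - b * c = 1 \<longrightarrow>
        (\<forall>z\<in>\<H>. f ((of_int a * z + of_int b) / (of_int c * z + of_int d)) =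
                  (of_int c * z + of_int d) powi w * f z)) \<and>
     (\<exists>a :: nat \<Rightarrow> complex. \<forall>z\<in>\<H>. (\<lambda>n. a n * qpow (of_nat n) z) sums f z)"

end

theory Submission
  imports
    Defs
    "HOL-Probability.Characteristic_Functions"
begin

text \<open>
  Both Wronskians have the form \<open>q powr (k * (k - 1) / 12)\<close> times a holomorphic function of \<open>q\<close> on the
  unit disc, and at \<open>q = 0\<close> the one for \<open>\<W>\<^sub>k\<close> is a Vandermonde determinant in the distinct exponents of the
  characters.  By the Jacobi triple product, \<open>\<eta> * ch i k\<close> is a theta series; Poisson summation on the
  imaginary axis and the identity theorem show that \<open>z \<mapsto> - 1 / z\<close> acts linearly on the span of the
  characters (the case \<open>k = 1\<close>, where the character is \<open>1\<close>, is the inversion of \<open>\<eta>\<close> itself).  Since the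
  chain rule for iterated derivatives of \<open>f (- 1 / z)\<close> is triangular, the two Wronskians transform with
  weights \<open>k * (k - 1)\<close> and \<open>k * (k - 1) + 2 * k\<close> and with the same multiplier, so their quotient has
  weight \<open>2 * k\<close>.  The quotient of the first Wronskian by \<open>\<eta> ^ (2 * k * (k - 1))\<close> is constant by the
  maximum modulus principle, hence the first Wronskian has no zeros and the quotient of the two is
  holomorphic, also at the cusp.
\<close>

section \<open>Fourier uniqueness on the circle\<close>

text \<open>The decisive fact is a numerical match: the first Wronskian has weight
  \<open>k * (k - 1)\<close>, and its order at the cusp, the sum of the exponents of the characters,
  is exactly one twelfth of that weight. The power of eta of the same weight has the same order
  there, so the quotient of the two has weight 0 and neither a zero nor a pole at the cusp. This
  takes the place of the valence formula: no zeros are left for the upper half-plane. Eta brings a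
  multiplier of its own, but inversion is an involution, so the constant in the transformation of
  this quotient squares to 1 and its modulus is invariant. The second Wronskian fits the same scheme
  because its rows start at order 1: a derivative of positive order of \<open>f (- 1 / z)\<close>
  contains no undifferentiated \<open>f\<close>, so the orders from 1 to \<open>k\<close> transform
  among themselves. The analysis takes place on the imaginary axis because \<open>q\<close> is real
  there and the theta terms are signed real Gaussians, which brings real products and the normal
  distribution into play.\<close>

lemma periodic_factor_circle:
  fixes h :: "real \<Rightarrow> complex"
  assumes cont: "continuous_on UNIV h" and per: "\<And>x. h (x + 1) = h x"
  obtains g where "continuous_on (sphere 0 1) g" "\<And>x. x \<in> {0..1} \<Longrightarrow> g (cis (2 * pi * x)) = h x"
proof -
  define g where "g = (\<lambda>w. h (Arg w / (2 * pi)))"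
  have per': "h (x - 1) = h x" for x using per[of "x - 1"] by simp
  have c1: "continuous_on (- \<real>\<^sub>\<le>\<^sub>0) g"
    unfolding g_def
    by (intro continuous_on_compose2[OF cont] continuous_intros) auto
  \<comment> \<open>\<open>Arg\<close> jumps along the negative axis by a full turn, which the
    period 1 of \<open>h\<close> absorbs. Half a turn moves the cut to the positive axis, and the
    two slit planes together cover the circle.\<close>
  have eq: "g w = h (Arg (- w) / (2 * pi) + 1/2)" if "w \<noteq> 0" for w
  proof (cases "Arg w \<le> 0")
    case True
    have "h ((Arg w + pi) / (2 * pi) + 1 / 2) = h (Arg w / (2 * pi) + 1)"
      by (intro arg_cong[of _ _ h]) (simp add: field_simps)
    with True that show ?thesis by (simp add: g_def Arg_minus per)
  next
    case False
    have "(Arg w - pi) / (2 * pi) + 1 / 2 = Arg w / (2 * pi)"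
      by (simp add: field_simps)
    with False that show ?thesis by (simp add: g_def Arg_minus per)
  qed
  have c2: "continuous_on (- \<real>\<^sub>\<ge>\<^sub>0) g"
  proof (rule continuous_on_eq)
    show "continuous_on (- \<real>\<^sub>\<ge>\<^sub>0) (\<lambda>w. h (Arg (- w) / (2 * pi) + 1/2))"
      by (intro continuous_on_compose2[OF cont] continuous_intros) (auto simp: complex_nonneg_Reals_iff complex_nonpos_Reals_iff complex_is_Real_iff)
  qed (metis Compl_iff eq nonneg_Reals_zero_I)
  have "open (- \<real>\<^sub>\<le>\<^sub>0 :: complex set)" "open (- \<real>\<^sub>\<ge>\<^sub>0 :: complex set)"
    by (auto intro!: open_Compl)
  hence "continuous_on (- \<real>\<^sub>\<le>\<^sub>0 \<union> - \<real>\<^sub>\<ge>\<^sub>0) g"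
    using c1 c2 by (rule continuous_on_open_Un)
  hence "continuous_on (sphere 0 1) g"
    by (rule continuous_on_subset) (auto simp: complex_nonneg_Reals_iff complex_nonpos_Reals_iff complex_eq_iff norm_complex_def)
  moreover have "g (cis (2 * pi * x)) = h x" if x: "x \<in> {0..1}" for x
  proof (cases "x \<le> 1/2")
    case True
    have "- pi < 2 * pi * x" using x pi_gt_zero by (smt (verit) atLeastAtMost_iff mult_nonneg_nonneg)
    moreover have "2 * pi * x \<le> pi" using mult_left_mono[of "2 * x" 1 pi] True by (simp add: mult_ac)
    ultimately have "Arg (cis (2 * pi * x)) = 2 * pi * x" by (subst Arg_cis) auto
    thus ?thesis by (simp add: g_def)
  next
    case False
    have "cis (2 * pi * x) = cis (2 * pi * (x - 1))"
      by (simp add: right_diff_distrib cis_divide[symmetric])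
    moreover have "- pi < 2 * pi * (x - 1)" "2 * pi * (x - 1) \<le> pi"
    proof -
      have "pi * 1 < pi * (2 * x)" using False by (intro mult_strict_left_mono) auto
      thus "- pi < 2 * pi * (x - 1)" by (simp add: algebra_simps)
      have "pi * (2 * x) \<le> pi * 2" using x by (intro mult_left_mono) auto
      thus "2 * pi * (x - 1) \<le> pi" using pi_gt_zero by (simp add: algebra_simps)
    qed
    ultimately have "Arg (cis (2 * pi * x)) = 2 * pi * (x - 1)" by (subst \<open>cis (2 * pi * x) = _\<close>, subst Arg_cis) auto
    thus ?thesis by (simp add: g_def per')
  qed
  ultimately show ?thesis using that by blast
qed

lemma continuous_on_real_polyfun: "real_polynomial_function p \<Longrightarrow> continuous_on UNIV p"
  by (simp add: continuous_on_eq_continuous_at continuous_real_polymonial_function)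

text \<open>A linear form on the circle is a combination of \<open>cis (2 * pi * x)\<close> and its
  inverse, hence only shifts the index \<open>m\<close> by one. Quantifying over \<open>u\<close>
  and all \<open>m\<close> makes the product case work: the first factor is absorbed into
  \<open>u\<close>, whose Fourier coefficients still vanish by the first induction
  hypothesis.\<close>

lemma orthogonal_polynomial_circle:
  fixes p :: "complex \<Rightarrow> real"
  assumes "real_polynomial_function p"
  assumes "continuous_on UNIV u" "\<And>m::int. integral {0..1} (\<lambda>x. u x * cis (2 * pi * m * x)) = 0"
  shows "integral {0..1} (\<lambda>x. u x * p (cis (2 * pi * x)) * cis (2 * pi * of_int m * x)) = (0::complex)"
  using assms
proof (induction p arbitrary: u m rule: real_polynomial_function.induct)
  case (linear f u m)
  have f: "f (cis (2 * pi * x)) = ((of_real (f 1) - \<i> * f \<i>) / 2) * cis (2 * pi * x) + ((of_real (f 1) + \<i> * f \<i>) / 2) * cis (- (2 * pi * x))" for x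
  proof -
    have *: "cis (2 * pi * x) = cos (2*pi*x) *\<^sub>R 1 + sin (2*pi*x) *\<^sub>R \<i>" by (simp add: complex_eq_iff)
    have "f (cis (2 * pi * x)) = cos (2*pi*x) * f 1 + sin (2*pi*x) * f \<i>"
      unfolding * using linear(1) by (simp add: linear_simps)
    thus ?thesis by (simp add: complex_eq_iff field_simps)
  qed
  have c: "u x * f (cis (2 * pi * x)) * cis (2 * pi * of_int m * x) =
      ((of_real (f 1) - \<i> * f \<i>) / 2) * (u x * cis (2 * pi * of_int (m + 1) * x)) +
      ((of_real (f 1) + \<i> * f \<i>) / 2) * (u x * cis (2 * pi * of_int (m - 1) * x))" for x
  proof -
    have e: "cis (2 * pi * of_int (m + 1) * x) = cis (2 * pi * x) * cis (2 * pi * of_int m * x)"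
            "cis (2 * pi * of_int (m - 1) * x) = cis (- (2 * pi * x)) * cis (2 * pi * of_int m * x)"
      by (simp_all add: cis_mult algebra_simps)
    show ?thesis unfolding f e by (simp only: algebra_simps)
  qed
  have i: "(\<lambda>x. u x * cis (2 * pi * of_int n * x)) integrable_on {0..1}" for n :: int
    by (intro integrable_continuous_interval continuous_intros continuous_on_subset[OF linear(2)]) auto
  show ?case
    unfolding c using linear(3)[of "m + 1"] linear(3)[of "m - 1"]
    using i[of "m + 1"] i[of "m - 1"]
    by (subst integral_add) (auto intro!: integrable_on_mult_right)
next
  case (const c u m)
  then show ?case by (subst mult.commute[of "u _"]) (simp add: mult.assoc)
next
  case (add f g u m)
  have i: "(\<lambda>x. u x * of_real (f (cis (2 * pi * x))) * cis (2 * pi * of_int m * x)) integrable_on {0..1}" 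
    if "real_polynomial_function f" for f
    by (intro integrable_continuous_interval continuous_intros continuous_on_subset[OF add.prems(1)] 
      continuous_on_compose2[OF continuous_on_real_polyfun[OF that]]) auto
  show ?case
    using add.IH(1)[OF add.prems, of m] add.IH(2)[OF add.prems, of m]
    by (simp add: distrib_left distrib_right integral_add i[OF add.hyps(1)] i[OF add.hyps(2)])
next
  case (mult f g u m)
  have "continuous_on UNIV (\<lambda>x. u x * of_real (f (cis (2 * pi * x))))"
    by (intro continuous_intros mult.prems(1)
      continuous_on_compose2[OF continuous_on_real_polyfun[OF mult.hyps(1)]]) auto
  from mult.IH(2)[OF this mult.IH(1)[OF mult.prems], of m]
  show ?case by (simp add: mult.assoc)
qed

text \<open>An L2 argument: by Stone-Weierstrass a polynomial \<open>p\<close> approximates the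
  conjugate of \<open>h\<close> uniformly, and \<open>h\<close> is orthogonal to \<open>p\<close> on
  the circle. So the integral of the squared modulus of \<open>h\<close> is smaller than any
  positive number, and continuity gives the pointwise claim.\<close>

lemma periodic_eq_0_if_fourier_coeffs_0:
  fixes h :: "real \<Rightarrow> complex"
  assumes cont: "continuous_on UNIV h" and per: "\<And>x. h (x + 1) = h x"
    and coeffs: "\<And>m::int. integral {0..1} (\<lambda>x. h x * cis (2 * pi * m * x)) = 0"
    and x: "x \<in> {0..1}"
  shows "h x = 0"
proof -
  obtain g where g: "continuous_on (sphere 0 1) g" "\<And>x. x \<in> {0..1} \<Longrightarrow> g (cis (2 * pi * x)) = h x"
    using periodic_factor_circle[OF cont per] by blast
  have cont1: "continuous_on {0..1} h" by (rule continuous_on_subset[OF cont]) auto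
  have "bounded (h ` {0..1})" by (intro compact_imp_bounded compact_continuous_image cont1) auto
  then obtain B where B: "B > 0" "\<And>x. x \<in> {0..1} \<Longrightarrow> norm (h x) \<le> B"
    unfolding bounded_pos by auto
  define I where "I = integral {0..1} (\<lambda>x. (norm (h x))\<^sup>2)"
  have "I \<le> 0 + e" if e: "e > 0" for e
  proof -
    have "e / B > 0" using e B by simp
    from Stone_Weierstrass_polynomial_function[OF _ _ this, of "sphere 0 1" "\<lambda>w. cnj (g w)"] g(1)
    obtain p where p: "polynomial_function p" "\<And>w. w \<in> sphere 0 1 \<Longrightarrow> norm (cnj (g w) - p w) < e / B"
      by (auto intro: continuous_intros)
    have pr: "real_polynomial_function (\<lambda>w. Re (p w))" "real_polynomial_function (\<lambda>w. Im (p w))"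
      using p(1) by (auto simp: polynomial_function_iff_Basis_inner Basis_complex_def)
    have cp: "continuous_on {0..1} (\<lambda>x. p (cis (2 * pi * x)))"
      by (intro continuous_intros continuous_on_compose2[OF continuous_on_polymonial_function[OF p(1), where S = UNIV]]) auto
    have cr: "continuous_on {0..1} (\<lambda>x. Re (p (cis (2 * pi * x))))" 
             "continuous_on {0..1} (\<lambda>x. Im (p (cis (2 * pi * x))))"
      using cp by (auto intro: continuous_intros)
    have "integral {0..1} (\<lambda>x. h x * p (cis (2 * pi * x))) =
          integral {0..1} (\<lambda>x. h x * Re (p (cis (2 * pi * x))) + \<i> * (h x * Im (p (cis (2 * pi * x)))))"
      by (intro integral_cong) (simp add: complex_eq_iff algebra_simps)
    also have "\<dots> = integral {0..1} (\<lambda>x. h x * Re (p (cis (2 * pi * x)))) + \<i> * integral {0..1} (\<lambda>x. h x * Im (p (cis (2 * pi * x))))"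
      by (subst integral_add) (auto intro!: integrable_continuous_interval continuous_intros cont1 cr)
    also have "\<dots> = 0"
      using orthogonal_polynomial_circle[OF pr(1) cont coeffs, of 0] orthogonal_polynomial_circle[OF pr(2) cont coeffs, of 0]
      by simp
    finally have z: "integral {0..1} (\<lambda>x. h x * p (cis (2 * pi * x))) = 0" .
    have "complex_of_real I = integral {0..1} (\<lambda>x. complex_of_real ((norm (h x))\<^sup>2))"
      unfolding I_def by (intro integral_linear[OF _ bounded_linear_of_real, unfolded o_def, symmetric] 
         integrable_continuous_interval continuous_intros cont1)
    also have "\<dots> = integral {0..1} (\<lambda>x. h x * (cnj (h x) - p (cis (2 * pi * x))) + h x * p (cis (2 * pi * x)))"
      by (intro integral_cong) (simp only: complex_norm_square algebra_simps)
    also have "\<dots> = integral {0..1} (\<lambda>x. h x * (cnj (h x) - p (cis (2 * pi * x))))"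
      using z by (subst integral_add) (auto intro!: integrable_continuous_interval continuous_intros cont1 cp)
    also have "norm \<dots> \<le> e * (1 - 0)"
    proof (rule integral_bound)
      show "continuous_on {0..1} (\<lambda>x. h x * (cnj (h x) - p (cis (2 * pi * x))))"
        by (intro continuous_intros cont1 cp)
      fix t :: real assume t: "t \<in> {0..1}"
      have "norm (cnj (h t) - p (cis (2 * pi * t))) \<le> e / B"
        using p(2)[of "cis (2 * pi * t)"] g(2)[OF t] by simp
      hence "norm (h t) * norm (cnj (h t) - p (cis (2 * pi * t))) \<le> B * (e / B)"
        using B t by (intro mult_mono) auto
      thus "norm (h t * (cnj (h t) - p (cis (2 * pi * t)))) \<le> e" using B by (simp add: norm_mult)
    qed auto
    finally show ?thesis by simp
  qed
  hence "I \<le> 0" by (rule field_le_epsilon)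
  moreover have "I \<ge> 0" unfolding I_def by (intro integral_nonneg integrable_continuous_interval continuous_intros cont1) auto
  ultimately have "integral {0..1} (\<lambda>x. (norm (h x))\<^sup>2) = 0" unfolding I_def by simp
  hence "(norm (h x))\<^sup>2 = 0"
    using x by (subst (asm) integral_eq_0_iff) (auto intro!: continuous_intros cont1)
  thus ?thesis by simp
qed

section \<open>Poisson summation for Gaussians\<close>

text \<open>Rescaling by \<open>s = sqrt (2 * pi * t)\<close> turns the Gaussian into the standard
  normal density, whose characteristic function is known.\<close>

lemma gaussian_fourier_transform:
  fixes t c :: real
  assumes t: "t > 0"
  defines "f \<equiv> \<lambda>y. complex_of_real (exp (- (pi * t * y\<^sup>2))) * cis (2 * pi * c * y)"
  shows "integrable lborel f" "(LBINT y. f y) = of_real (exp (- (pi * c\<^sup>2 / t)) / sqrt t)"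
proof -
  define s where "s = sqrt (2 * pi * t)"
  have s: "s > 0" "s\<^sup>2 = 2 * pi * t" using t by (auto simp: s_def)
  define \<psi> where "\<psi> = (\<lambda>x. std_normal_density x *\<^sub>R iexp (2 * pi * c / s * x))"
  have char: "(LBINT x. \<psi> x) = of_real (exp (- (2 * pi * c / s)\<^sup>2 / 2))"
  proof -
    have "(CLINT x|std_normal_distribution. iexp (2 * pi * c / s * x)) = of_real (exp (- (2 * pi * c / s)\<^sup>2 / 2))"
      using fun_cong[OF char_std_normal_distribution, of "2 * pi * c / s"] unfolding char_def by simp
    thus ?thesis unfolding \<psi>_def by (subst (asm) integral_density) auto
  qed
  have int: "integrable lborel \<psi>" unfolding \<psi>_def
    by (rule Bochner_Integration.integrable_bound[OF integrable_normal_density[of 1 0]]) auto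
  have eq: "f y = (s / sqrt t) *\<^sub>R \<psi> (0 + s * y)" for y
  proof -
    have "iexp (2 * pi * c / s * (s * y)) = cis (2 * pi * c * y)"
      using s by (simp add: cis_conv_exp mult_ac)
    moreover have "(s / sqrt t) * std_normal_density (s * y) = exp (- (pi * t * y\<^sup>2))"
      using t unfolding std_normal_density_def power_mult_distrib s(2) 
      by (simp add: s_def real_sqrt_mult)
    ultimately have "f y = of_real ((s / sqrt t) * std_normal_density (s * y)) * iexp (2 * pi * c / s * (s * y))"
      by (simp only: f_def)
    thus ?thesis by (simp add: \<psi>_def scaleR_conv_of_real)
  qed
  show "integrable lborel f"
    unfolding eq using lborel_integrable_real_affine[OF int, of s 0] s by simp
  have "(LBINT y. f y) = (s / sqrt t) *\<^sub>R (LBINT y. \<psi> (0 + s * y))"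
    unfolding eq by simp
  also have "(LBINT y. \<psi> (0 + s * y)) = (1 / s) *\<^sub>R (LBINT x. \<psi> x)"
    using lborel_integral_real_affine[of s \<psi> 0] s by (simp add: field_simps)
  also have "(LBINT x. \<psi> x) = of_real (exp (- (pi * c\<^sup>2 / t)))"
  proof -
    have "- (2 * pi * c / s)\<^sup>2 / 2 = - (pi * c\<^sup>2 / t)"
      unfolding power_divide s(2) using t by (simp add: field_simps power2_eq_square)
    with char show ?thesis by simp
  qed
  finally show "(LBINT y. f y) = of_real (exp (- (pi * c\<^sup>2 / t)) / sqrt t)"
    using s by (simp add: scaleR_conv_of_real)
qed

section \<open>Geometric majorants for shifted Gaussians, and exchange of sums with limits and
  integrals\<close>

lemma summable_on_int_power_abs:
  fixes r :: real
  assumes "0 \<le> r" "r < 1"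
  shows "(\<lambda>n::int. r ^ nat \<bar>n\<bar>) summable_on UNIV"
proof -
  have *: "(\<lambda>n. r ^ n) summable_on UNIV"
    using assms by (intro norm_summable_imp_summable_on summable_geometric) auto
  have "(\<lambda>n::int. r ^ nat \<bar>n\<bar>) summable_on (range int)"
    by (subst summable_on_reindex) (use * in \<open>auto simp: o_def\<close>)
  moreover have "(\<lambda>n::int. r ^ nat \<bar>n\<bar>) summable_on (range (\<lambda>n. - int n - 1))"
  proof (subst summable_on_reindex)
    have "nat \<bar>- int n - 1\<bar> = Suc n" for n by simp
    thus "(\<lambda>n. r ^ nat \<bar>n\<bar>) \<circ> (\<lambda>n. - int n - 1) summable_on UNIV"
      unfolding o_def using summable_on_cmult_right[OF *, of r] by simp
  qed (auto simp: inj_on_def)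
  ultimately have "(\<lambda>n::int. r ^ nat \<bar>n\<bar>) summable_on (range int \<union> range (\<lambda>n. - int n - 1))"
    by (rule summable_on_Un_disjoint) auto
  also have "range int \<union> range (\<lambda>n. - int n - 1) = UNIV"
  proof (intro equalityI subsetI UNIV_I)
    fix n :: int
    show "n \<in> range int \<union> range (\<lambda>n. - int n - 1)"
      by (cases "n \<ge> 0") (auto simp: image_iff intro: exI[of _ "nat n"] exI[of _ "nat (- n - 1)"])
  qed
  finally show ?thesis .
qed

text \<open>From \<open>\<bar>n\<bar> \<le> n^2 \<le> 2 * (n + x)^2 + 2 * x^2\<close> the quadratic
  exponent is traded for a linear one, which leaves a geometric majorant that is uniform in
  \<open>x\<close> on bounded sets.\<close>

lemma gaussian_shift_le:
  fixes t x R :: real and n :: int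
  assumes "t > 0" "\<bar>x\<bar> \<le> R"
  shows "exp (- (pi * t * (of_int n + x)\<^sup>2)) \<le> exp (pi * t * R\<^sup>2) * exp (- (pi * t / 2)) ^ nat \<bar>n\<bar>"
proof -
  have "\<bar>n\<bar> \<le> \<bar>n\<bar>\<^sup>2"
  proof (cases "n = 0")
    case False
    hence "\<bar>n\<bar> * 1 \<le> \<bar>n\<bar> * \<bar>n\<bar>" by (intro mult_left_mono) linarith+
    thus ?thesis by (simp add: power2_eq_square)
  qed auto
  hence "\<bar>n\<bar> \<le> n\<^sup>2" by simp
  hence "real_of_int \<bar>n\<bar> \<le> (real_of_int n)\<^sup>2"
    unfolding of_int_power[symmetric] of_int_le_iff .
  also have "\<dots> \<le> 2 * (of_int n + x)\<^sup>2 + 2 * x\<^sup>2"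
    using zero_le_power2[of "of_int n + 2 * x"] by (simp add: power2_eq_square algebra_simps)
  also have "x\<^sup>2 \<le> R\<^sup>2" using assms(2) by (metis abs_ge_zero power2_abs power_mono)
  finally have "real_of_int \<bar>n\<bar> / 2 - R\<^sup>2 \<le> (of_int n + x)\<^sup>2" by simp
  hence "pi * t * (real_of_int \<bar>n\<bar> / 2 - R\<^sup>2) \<le> pi * t * (of_int n + x)\<^sup>2"
    using assms by (intro mult_left_mono) auto
  hence "exp (- (pi * t * (of_int n + x)\<^sup>2)) \<le> exp (- (pi * t * (real_of_int \<bar>n\<bar> / 2 - R\<^sup>2)))" by simp
  also have "\<dots> = exp (pi * t * R\<^sup>2) * exp (real (nat \<bar>n\<bar>) * (- (pi * t / 2)))"
    by (simp add: algebra_simps flip: exp_add)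
  finally show ?thesis by (subst (asm) exp_of_nat_mult)
qed

lemma gaussian_bound_summable:
  fixes t R :: real
  assumes "t > 0"
  shows "(\<lambda>n::int. exp (pi * t * R\<^sup>2) * exp (- (pi * t / 2)) ^ nat \<bar>n\<bar>) summable_on UNIV"
  using assms by (intro summable_on_cmult_right summable_on_int_power_abs) auto

lemma has_sum_integral_uniform:
  fixes f :: "int \<Rightarrow> real \<Rightarrow> complex"
  assumes "\<And>n. continuous_on {0..1} (f n)" "\<And>n x. x \<in> {0..1} \<Longrightarrow> norm (f n x) \<le> M n" "M summable_on UNIV"
  shows "((\<lambda>n. integral {0..1} (f n)) has_sum integral {0..1} (\<lambda>x. \<Sum>\<^sub>\<infinity>n. f n x)) UNIV"
proof -
  have u: "uniform_limit {0..1} (\<lambda>X y. \<Sum>x\<in>X. f x y) (\<lambda>y. \<Sum>\<^sub>\<infinity>x. f x y) (finite_subsets_at_top UNIV)"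
    using assms by (intro Weierstrass_m_test_general) auto
  obtain I J where IJ: "\<And>X. ((\<lambda>y. \<Sum>x\<in>X. f x y) has_integral I X) {0..1}"
     "((\<lambda>y. \<Sum>\<^sub>\<infinity>x. f x y) has_integral J) {0..1}" "(I \<longlongrightarrow> J) (finite_subsets_at_top UNIV)"
    by (rule uniform_limit_integral[OF u]) (auto intro!: continuous_intros assms)
  have "I X = (\<Sum>x\<in>X. integral {0..1} (f x))" if "finite X" for X
    using IJ(1)[of X] that unfolding integral_unique[OF IJ(1)[of X], symmetric] by (subst integral_sum[symmetric]) (auto intro!: integrable_continuous_interval assms)
  hence "\<forall>\<^sub>F X in finite_subsets_at_top UNIV. I X = (\<Sum>x\<in>X. integral {0..1} (f x))"
    by (intro eventually_finite_subsets_at_top_weakI) auto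
  hence "((\<lambda>X. \<Sum>x\<in>X. integral {0..1} (f x)) \<longlongrightarrow> J) (finite_subsets_at_top UNIV)"
    using IJ(3) by (rule Lim_transform_eventually[rotated])
  thus ?thesis using IJ(2) by (simp add: has_sum_def integral_unique)
qed

text \<open>The majorant depends on \<open>R\<close> because no summable sequence dominates all
  translates of a Gaussian on the whole real line at once.\<close>

lemma continuous_on_infsum_local:
  fixes f :: "int \<Rightarrow> real \<Rightarrow> complex"
  assumes "\<And>n. continuous_on UNIV (f n)" "\<And>R n x. \<bar>x\<bar> \<le> R \<Longrightarrow> norm (f n x) \<le> M R n" "\<And>R. M R summable_on UNIV"
  shows "continuous_on UNIV (\<lambda>x. \<Sum>\<^sub>\<infinity>n. f n x)"
proof -
  have c: "continuous_on (ball 0 R) (\<lambda>x. \<Sum>\<^sub>\<infinity>n. f n x)" for R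
  proof (rule uniform_limit_theorem)
    show "uniform_limit (ball 0 R) (\<lambda>X y. \<Sum>x\<in>X. f x y) (\<lambda>y. \<Sum>\<^sub>\<infinity>x. f x y) (finite_subsets_at_top UNIV)"
      by (rule Weierstrass_m_test_general[where M = "M R"]) (auto intro!: assms)
    show "\<forall>\<^sub>F X in finite_subsets_at_top UNIV. continuous_on (ball 0 R) (\<lambda>y. \<Sum>x\<in>X. f x y)"
      by (intro always_eventually allI continuous_intros continuous_on_subset[OF assms(1)]) auto
  qed auto
  have "isCont (\<lambda>x. \<Sum>\<^sub>\<infinity>n. f n x) x" for x
    using c[of "\<bar>x\<bar> + 1"] by (subst (asm) continuous_on_eq_continuous_at) auto
  thus ?thesis by (simp add: continuous_on_eq_continuous_at)
qed

lemma integral_cis_int: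
  "integral {0..1} (\<lambda>x. cis (2 * pi * of_int m * x)) = (if m = 0 then 1 else 0)"
proof (cases "m = 0")
  case False
  define c where "c = 2 * pi * \<i> * of_int m"
  have c: "c \<noteq> 0" using False by (simp add: c_def)
  have e: "cis (2 * pi * of_int m * x) = exp (c * of_real x)" for x
    by (simp add: cis_conv_exp c_def mult_ac)
  have "((\<lambda>x. exp (c * of_real x)) has_integral (exp (c * of_real 1) / c - exp (c * of_real 0) / c)) {0..1}"
  proof (rule fundamental_theorem_of_calculus)
    fix x :: real assume "x \<in> {0..1}"
    show "((\<lambda>x. exp (c * of_real x) / c) has_vector_derivative exp (c * of_real x)) (at x within {0..1})"
      using c by (auto intro!: derivative_eq_intros has_vector_derivative_real_field)
  qed auto
  moreover have "exp c = 1" 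
    using e[of 1] cis_multiple_2pi[of "of_int m"] by (simp add: mult_ac)
  ultimately show ?thesis using False c unfolding e by (simp add: integral_unique)
qed auto

text \<open>As functions of \<open>u\<close> both sides are continuous with period 1, so it is
  enough to compare Fourier coefficients. On the left they unfold to a Fourier transform over the
  real line; on the right they can be read off. The twist by \<open>v\<close> becomes a shift on the
  dual side.\<close>

theorem poisson_gaussian:
  fixes t u v :: real
  assumes t: "t > 0" and u: "u \<in> {0..1}"
  shows "(\<Sum>\<^sub>\<infinity>n::int. of_real (exp (- (pi * t * (of_int n + u)\<^sup>2))) * cis (2 * pi * v * (of_int n + u))) =
         of_real (1 / sqrt t) * (\<Sum>\<^sub>\<infinity>m::int. of_real (exp (- (pi / t * (of_int m - v)\<^sup>2))) * cis (2 * pi * of_int m * u))"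
proof -
  define f where "f = (\<lambda>y. complex_of_real (exp (- (pi * t * y\<^sup>2))) * cis (2 * pi * v * y))"
  define g where "g = (\<lambda>m::int. exp (- (pi / t * (of_int m - v)\<^sup>2)) / sqrt t)"
  define F where "F = (\<lambda>x. \<Sum>\<^sub>\<infinity>n::int. f (of_int n + x))"
  define G where "G = (\<lambda>x. \<Sum>\<^sub>\<infinity>m::int. of_real (g m) * cis (2 * pi * of_int m * x))"
  define M where "M = (\<lambda>R (n::int). exp (pi * t * R\<^sup>2) * exp (- (pi * t / 2)) ^ nat \<bar>n\<bar>)"
  have M: "M R summable_on UNIV" for R unfolding M_def by (rule gaussian_bound_summable[OF t])
  have fM: "norm (f (of_int n + x)) \<le> M R n" if "\<bar>x\<bar> \<le> R" for n x R
    using gaussian_shift_le[OF t that, of n] by (simp add: f_def M_def norm_mult)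
  have fcont: "continuous_on A f" for A
    unfolding f_def by (intro continuous_intros)
  have fcont': "continuous_on A (\<lambda>x. f (of_int n + x))" for n :: int and A
    by (intro continuous_on_compose2[OF fcont[of UNIV]] continuous_intros) auto
  have F: "continuous_on UNIV F" unfolding F_def
    by (rule continuous_on_infsum_local[where M = M]) (use fcont' fM M in auto)
  have Fper: "F (x + 1) = F x" for x
    unfolding F_def 
    by (rule infsum_reindex_bij_witness[of UNIV "\<lambda>n. n - 1" "\<lambda>n. n + 1"]) (auto simp: algebra_simps)
  have g0: "g m \<ge> 0" for m using t by (simp add: g_def)
  have gsum: "g summable_on UNIV"
  proof (rule summable_on_comparison_test)
    show "(\<lambda>n::int. (exp (pi * (1/t) * \<bar>v\<bar>\<^sup>2) * exp (- (pi * (1/t) / 2)) ^ nat \<bar>n\<bar>) * (1 / sqrt t)) summable_on UNIV"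
      by (intro summable_on_cmult_left gaussian_bound_summable) (use t in auto)
    show "g n \<le> (exp (pi * (1/t) * \<bar>v\<bar>\<^sup>2) * exp (- (pi * (1/t) / 2)) ^ nat \<bar>n\<bar>) * (1 / sqrt t)" for n
      using gaussian_shift_le[of "1/t" "- v" "\<bar>v\<bar>" n] t by (auto simp: g_def divide_right_mono)
  qed (use g0 in auto)
  have gM: "norm (of_real (g m) * cis (2 * pi * of_int m * x)) \<le> g m" for m x
    using g0[of m] by (simp add: norm_mult)
  have G: "continuous_on UNIV G" unfolding G_def
    by (rule continuous_on_infsum_local[where M = "\<lambda>_. g"]) (auto intro!: continuous_intros gsum gM)
  have Gper: "G (x + 1) = G x" for x
  proof -
    have "cis (2 * pi * of_int m * (x + 1)) = cis (2 * pi * of_int m * x)" for m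
      by (simp add: distrib_left cis_multiple_2pi flip: cis_mult)
    thus ?thesis by (simp add: G_def)
  qed
  \<comment> \<open>Pairing with \<open>cis (2 * pi * j * x)\<close> rather than with its conjugate
    picks out the coefficient of index \<open>- j\<close>.\<close>
  have coeffF: "integral {0..1} (\<lambda>x. F x * cis (2 * pi * of_int j * x)) = of_real (g (- j))" for j
  proof -
    define \<phi> where "\<phi> = (\<lambda>y. complex_of_real (exp (- (pi * t * y\<^sup>2))) * cis (2 * pi * (v + of_int j) * y))"
    have \<phi>: "integrable lborel \<phi>" "(LBINT y. \<phi> y) = of_real (g (- j))"
    proof -
      have "(- real_of_int j - v)\<^sup>2 = (v + of_int j)\<^sup>2" by (simp add: power2_eq_square algebra_simps)
      thus "integrable lborel \<phi>" "(LBINT y. \<phi> y) = of_real (g (- j))"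
      using gaussian_fourier_transform[OF t, of "v + of_int j"] by (simp_all add: \<phi>_def g_def)
    qed
    have \<phi>cont: "continuous_on A \<phi>" for A unfolding \<phi>_def by (intro continuous_intros)
    \<comment> \<open>An integer shift does not change the character of index \<open>j\<close>, so
      the summands are the pieces of one integrand \<open>\<phi>\<close> over consecutive unit
      intervals.\<close>
    have eq: "integral {0..1} (\<lambda>x. f (of_int n + x) * cis (2 * pi * of_int j * x)) = integral {of_int n..of_int n+1} \<phi>" for n :: int
    proof -
      have "f (of_int n + x) * cis (2 * pi * of_int j * x) = \<phi> (x + of_int n)" for x
      proof -
        have "cis (2 * pi * of_int j * of_int n) = 1"
          using cis_multiple_2pi[of "of_int (j * n)"] by (simp add: mult_ac)
        hence "cis (2 * pi * of_int j * x) = cis (2 * pi * of_int j * (x + of_int n))"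
          by (simp add: distrib_left flip: cis_mult)
        thus ?thesis by (simp add: f_def \<phi>_def cis_mult algebra_simps)
      qed
      thus ?thesis
        using integral_shift_Icc_real[of 0 1 \<phi> "of_int n"] by (simp add: add.commute o_def)
    qed
    have "((\<lambda>n::int. integral {0..1} (\<lambda>x. f (of_int n + x) * cis (2 * pi * of_int j * x))) has_sum 
            integral {0..1} (\<lambda>x. \<Sum>\<^sub>\<infinity>n::int. f (of_int n + x) * cis (2 * pi * of_int j * x))) UNIV"
      by (rule has_sum_integral_uniform[where M = "M 1"]) (auto intro!: continuous_intros fcont' M simp: norm_mult intro: fM)
    hence *: "((\<lambda>n::int. integral {of_int n..of_int n+1} \<phi>) has_sum integral {0..1} (\<lambda>x. F x * cis (2 * pi * of_int j * x))) UNIV"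
      unfolding eq by (simp add: infsum_cmult_left' F_def)
    \<comment> \<open>The unordered sum may be evaluated along half-open index windows, whose unit
      intervals tile \<open>{- N..N}\<close> exactly.\<close>
    have fl: "filterlim (\<lambda>N::nat. {- int N..<int N}) (finite_subsets_at_top UNIV) sequentially"
      unfolding filterlim_finite_subsets_at_top
    proof (intro allI impI)
      fix X :: "int set" assume "finite X \<and> X \<subseteq> UNIV"
      hence fin: "finite X" by simp
      define N0 where "N0 = Suc (nat (Max (insert 0 (abs ` X))))"
      have "\<bar>x\<bar> < int N0" if "x \<in> X" for x
      proof -
        have "\<bar>x\<bar> \<le> Max (insert 0 (abs ` X))" using that fin by (intro Max_ge) auto
        thus ?thesis unfolding N0_def by linarith
      qed
      hence "X \<subseteq> {- int N..<int N}" if "N \<ge> N0" for N using that by fastforce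
      thus "\<forall>\<^sub>F N in sequentially. finite {- int N..<int N} \<and> X \<subseteq> {- int N..<int N} \<and> {- int N..<int N} \<subseteq> UNIV"
        by (auto simp: eventually_sequentially)
    qed
    have "(\<lambda>N::nat. \<Sum>n\<in>{- int N..<int N}. integral {of_int n..of_int n+1} \<phi>) \<longlonglongrightarrow> integral {0..1} (\<lambda>x. F x * cis (2 * pi * of_int j * x))"
      using filterlim_compose[OF *[unfolded has_sum_def] fl] .
    moreover have "(\<Sum>n\<in>{- int N..<int N}. integral {of_int n..of_int n+1} \<phi>) = integral {- real N..real N} \<phi>" for N
    proof (induction N)
      case (Suc N)
      have "{- int (Suc N)..<int (Suc N)} = insert (- int (Suc N)) (insert (int N) {- int N..<int N})" by auto
      hence "(\<Sum>n\<in>{- int (Suc N)..<int (Suc N)}. integral {of_int n..of_int n+1} \<phi>) = 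
         integral {- real (Suc N)..- real N} \<phi> + (integral {real N..real (Suc N)} \<phi> + integral {- real N..real N} \<phi>)"
        using Suc by (simp add: algebra_simps)
      also have "integral {real N..real (Suc N)} \<phi> + integral {- real N..real N} \<phi> = integral {- real N..real (Suc N)} \<phi>"
        by (subst add.commute, rule Henstock_Kurzweil_Integration.integral_combine) (auto intro!: integrable_continuous_interval \<phi>cont)
      also have "integral {- real (Suc N)..- real N} \<phi> + \<dots> = integral {- real (Suc N)..real (Suc N)} \<phi>"
        by (rule Henstock_Kurzweil_Integration.integral_combine) (auto intro!: integrable_continuous_interval \<phi>cont)
      finally show ?case .
    qed auto
    moreover have "(\<lambda>N. integral {- real N..real N} \<phi>) \<longlonglongrightarrow> (LBINT y. \<phi> y)"
    proof -
      have "(\<lambda>N. LBINT y. indicator {- real N..real N} y *\<^sub>R \<phi> y) \<longlonglongrightarrow> (LBINT y. \<phi> y)"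
      proof (rule integral_dominated_convergence)
        show "integrable lborel (\<lambda>y. norm (\<phi> y))" using \<phi>(1) by simp
        show "AE y in lborel. (\<lambda>N. indicator {- real N..real N} y *\<^sub>R \<phi> y) \<longlonglongrightarrow> \<phi> y"
        proof (rule AE_I2, rule tendsto_eventually)
          fix y
          show "\<forall>\<^sub>F N in sequentially. indicator {- real N..real N} y *\<^sub>R \<phi> y = \<phi> y"
            using eventually_ge_at_top[of "nat \<lceil>\<bar>y\<bar>\<rceil>"] by eventually_elim (auto simp: indicator_def split: if_splits) 
        qed
        show "(\<lambda>y. indicator {- real N..real N} y *\<^sub>R \<phi> y) \<in> borel_measurable lborel" for N
          using \<phi>(1) by auto
      qed (use \<phi>(1) in \<open>auto simp: indicator_def\<close>)
      moreover have "(LBINT y. indicator {- real N..real N} y *\<^sub>R \<phi> y) = integral {- real N..real N} \<phi>" for N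
        using set_borel_integral_eq_integral(2)[of "{- real N..real N}" \<phi>] borel_integrable_atLeastAtMost'[OF \<phi>cont]
        by (simp add: set_lebesgue_integral_def)
      ultimately show ?thesis by simp
    qed
    ultimately show ?thesis using LIMSEQ_unique \<phi>(2) by auto
  qed
  have coeffG: "integral {0..1} (\<lambda>x. G x * cis (2 * pi * of_int j * x)) = of_real (g (- j))" for j
  proof -
    have "((\<lambda>m::int. integral {0..1} (\<lambda>x. of_real (g m) * cis (2 * pi * of_int m * x) * cis (2 * pi * of_int j * x))) has_sum 
            integral {0..1} (\<lambda>x. \<Sum>\<^sub>\<infinity>m::int. of_real (g m) * cis (2 * pi * of_int m * x) * cis (2 * pi * of_int j * x))) UNIV"
      by (rule has_sum_integral_uniform[where M = g]) (use gM g0 in \<open>auto intro!: continuous_intros gsum simp: norm_mult\<close>)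
    moreover have "integral {0..1} (\<lambda>x. of_real (g m) * cis (2 * pi * of_int m * x) * cis (2 * pi * of_int j * x)) = 
        (if m = - j then of_real (g m) else 0)" for m
    proof -
      have "of_real (g m) * cis (2 * pi * of_int m * x) * cis (2 * pi * of_int j * x) = of_real (g m) * cis (2 * pi * of_int (m + j) * x)" for x
        by (simp add: cis_mult algebra_simps)
      thus ?thesis by (simp only: integral_mult_right integral_cis_int) auto
    qed
    moreover have "((\<lambda>m. if m = - j then complex_of_real (g m) else 0) has_sum of_real (g (- j))) UNIV"
    proof -
      have "((\<lambda>m. if m = - j then complex_of_real (g m) else 0) has_sum of_real (g (- j))) {- j}"
        using has_sum_finite[of "{- j}" "\<lambda>m. if m = - j then complex_of_real (g m) else 0"] by simp
      thus ?thesis by (rule has_sum_cong_neutral[THEN iffD1, rotated 3]) auto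
    qed
    ultimately show ?thesis
      by (simp add: infsum_cmult_left' G_def has_sum_unique)
  qed
  have "F u - G u = 0"
  proof (rule periodic_eq_0_if_fourier_coeffs_0[of "\<lambda>x. F x - G x"])
    fix m :: int
    have "(\<lambda>x. F x * cis (2 * pi * of_int m * x)) integrable_on {0..1}" "(\<lambda>x. G x * cis (2 * pi * of_int m * x)) integrable_on {0..1}"
      by (intro integrable_continuous_interval continuous_intros continuous_on_subset[OF F] continuous_on_subset[OF G]; simp)+
    thus "integral {0..1} (\<lambda>x. (F x - G x) * cis (2 * pi * of_int m * x)) = 0"
      by (simp add: left_diff_distrib integral_diff coeffF coeffG)
  qed (use u in \<open>auto intro!: continuous_intros F G simp: Fper Gper\<close>)
  thus ?thesis
    by (simp add: F_def G_def f_def g_def divide_inverse mult_ac flip: infsum_cmult_right')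
qed

section \<open>The Jacobi triple product\<close>

text \<open>The q-Pochhammer symbol (q; q)_n, for real \<open>q\<close> only, since the triple
  product is applied on the imaginary axis.\<close>

definition qpoch :: "real \<Rightarrow> nat \<Rightarrow> real" where
  "qpoch q n = (\<Prod>i<n. 1 - q ^ Suc i)"

lemma qpoch_Suc: "qpoch q (Suc n) = qpoch q n * (1 - q ^ Suc n)"
  by (simp add: qpoch_def)

lemma qpoch_pos: "0 < q \<Longrightarrow> q < 1 \<Longrightarrow> qpoch q n > 0"
  unfolding qpoch_def by (intro prod_pos) (auto simp: power_Suc_less_one simp del: power_Suc)

text \<open>The sequence decreases to the nonzero infinite product. The two-sided bound by
  \<open>L\<close> and 1 is what later bounds all q-binomial coefficients uniformly.\<close>

lemma qpoch_limit:
  assumes q: "0 < q" "q < 1"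
  obtains L where "qpoch q \<longlonglongrightarrow> L" "L > 0" "\<And>n. L \<le> qpoch q n" "\<And>n. qpoch q n \<le> 1"
proof -
  have "summable (\<lambda>n. norm (- (q ^ Suc n)))"
    using q by (auto intro!: summable_mult summable_geometric)
  hence "abs_convergent_prod (\<lambda>n. 1 + - (q ^ Suc n))"
    by (intro summable_imp_abs_convergent_prod) (simp add: algebra_simps)
  hence conv: "convergent_prod (\<lambda>n. 1 - q ^ Suc n)"
    using abs_convergent_prod_imp_convergent_prod by (simp only: add_uminus_conv_diff)
  define L where "L = prodinf (\<lambda>n. 1 - q ^ Suc n)"
  have "(\<lambda>n. qpoch q (Suc n)) \<longlonglongrightarrow> L"
    using convergent_prod_LIMSEQ[OF conv] by (simp add: qpoch_def L_def lessThan_Suc_atMost)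
  hence lim: "qpoch q \<longlonglongrightarrow> L" by (rule LIMSEQ_imp_Suc)
  have mono: "decseq (qpoch q)"
    using q qpoch_pos[OF q] by (intro decseq_SucI) (simp add: qpoch_Suc right_diff_distrib less_imp_le del: power_Suc)
  have "L \<noteq> 0" unfolding L_def using q
    by (intro prodinf_nonzero conv) (metis diff_gt_0_iff_gt less_irrefl power_Suc_less_one)
  moreover have "0 \<le> L" using lim qpoch_pos[OF q] by (intro LIMSEQ_le_const) (auto intro: less_imp_le)
  moreover have "qpoch q n \<le> 1" for n using decseqD[OF mono, of 0 n] by (simp add: qpoch_def)
  moreover have "L \<le> qpoch q n" for n by (rule decseq_ge[OF mono lim])
  ultimately show ?thesis using lim that[of L] by (simp add: order_less_le)
qed

text \<open>The q-binomial theorem. The coefficients obey a q-Pascal rule, which is the induction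
  step.\<close>

lemma gauss_binomial:
  assumes q: "0 < q" "q < 1"
  shows "(\<Prod>n<M. 1 + y * q ^ n) = (\<Sum>r\<le>M. qpoch q M / (qpoch q r * qpoch q (M - r)) * q ^ (r * (r - 1) div 2) * y ^ r)"
proof (induction M)
  case (Suc M)
  define b where "b = (\<lambda>M r. qpoch q M / (qpoch q r * qpoch q (M - r)) * q ^ (r * (r - 1) div 2) * y ^ r)"
  have nz: "qpoch q n \<noteq> 0" for n using qpoch_pos[OF q, of n] by simp
  have top: "b (Suc M) (Suc M) = b M M * (y * q ^ M)"
  proof -
    have "Suc M * (Suc M - 1) div 2 = M * (M - 1) div 2 + M"
      by (cases M) (auto simp: algebra_simps)
    moreover have "qpoch q 0 = 1" by (simp add: qpoch_def)
    ultimately show ?thesis using nz[of M] nz[of "Suc M"] unfolding b_def by (simp add: power_add mult_ac)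
  qed
  \<comment> \<open>The q-Pascal rule. Writing \<open>M = Suc (r + d)\<close> removes all truncated
    subtractions, so that the claim becomes a polynomial identity after clearing
    denominators.\<close>
  have mid: "b (Suc M) (Suc r) = b M (Suc r) + b M r * (y * q ^ M)" if r: "r < M" for r
  proof -
    obtain d where d: "M = Suc (r + d)" using r less_iff_Suc_add by auto
    have e: "Suc r * (Suc r - 1) div 2 = r * (r - 1) div 2 + r"
      by (cases r) (auto simp: algebra_simps)
    have "q ^ M = q ^ r * q ^ Suc d" by (simp add: d power_add)
    thus ?thesis using nz[of r] nz[of d] nz[of "Suc r"] nz[of "Suc d"]
      unfolding b_def e by (simp add: d qpoch_Suc power_add divide_simps del: power_Suc) (simp add: power_add algebra_simps)
  qed
  have b0: "b N 0 = 1" for N using nz by (simp add: b_def) (simp add: qpoch_def)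
  have "(\<Prod>n<Suc M. 1 + y * q ^ n) = (\<Sum>r\<le>M. b M r) + (\<Sum>r\<le>M. b M r * (y * q ^ M))"
    using Suc unfolding prod.lessThan_Suc b_def by (simp add: distrib_left sum_distrib_right)
  also have "(\<Sum>r\<le>M. b M r) = 1 + (\<Sum>r<M. b M (Suc r))"
    by (simp add: sum.atMost_shift b0)
  also have "(\<Sum>r\<le>M. b M r * (y * q ^ M)) = (\<Sum>r<M. b M r * (y * q ^ M)) + b M M * (y * q ^ M)"
    by (simp flip: lessThan_Suc_atMost)
  also have "1 + (\<Sum>r<M. b M (Suc r)) + ((\<Sum>r<M. b M r * (y * q ^ M)) + b M M * (y * q ^ M)) =
             1 + (\<Sum>r<M. b (Suc M) (Suc r)) + b (Suc M) (Suc M)"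
    by (simp add: mid top sum.distrib)
  also have "\<dots> = (\<Sum>r\<le>Suc M. b (Suc M) r)"
    by (simp add: sum.atMost_shift b0 lessThan_Suc)
  finally show ?case by (simp add: b_def)
qed (simp add: qpoch_def)

text \<open>The integer division is exact, since \<open>j * (j - 1)\<close> is even.\<close>

definition jacobi_term :: "real \<Rightarrow> real \<Rightarrow> int \<Rightarrow> real" where
  "jacobi_term q x j = q powi (j * (j - 1) div 2) * x powi j"

lemma triangle_int_add: "(a + b) * (a + b - 1) div 2 = a * (a - 1) div 2 + b * (b - 1) div 2 + a * (b::int)"
proof -
  have 1: "2 dvd n * (n - 1)" for n :: int by simp
  have "(a + b) * (a + b - 1) = a * (a - 1) + b * (b - 1) + a * b * 2" by (simp add: algebra_simps)
  thus ?thesis using 1 by (simp add: div_plus_div_distrib_dvd_left)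
qed

text \<open>The q-binomial theorem with \<open>2 * N\<close> factors, recentred: with
  \<open>y = x * q powi (- N)\<close> the last \<open>N\<close> factors are those in
  \<open>x\<close>, while each of the first \<open>N\<close>, after its dominant term is pulled out,
  becomes a factor in \<open>1 / x\<close>. The summation index \<open>r\<close> turns into
  \<open>j = r - N\<close>.\<close>

lemma finite_jacobi:
  fixes q x :: real
  assumes q: "0 < q" "q < 1" and x: "x \<noteq> 0"
  shows "(\<Prod>n<N. 1 + x * q ^ n) * (\<Prod>n<N. 1 + q ^ Suc n / x) =
    (\<Sum>j\<in>{- int N..int N}. qpoch q (2 * N) / (qpoch q (nat (int N + j)) * qpoch q (nat (int N - j))) * jacobi_term q x j)"
proof -
  define y where "y = x * q powi (- int N)"
  \<comment> \<open>The product of the terms \<open>x * q powi (- Suc n)\<close> pulled out of the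
    first \<open>N\<close> factors; the same constant comes out of every summand and
    cancels.\<close>
  define K where "K = x ^ N * q powi (- (int N * (int N + 1) div 2))"
  have K: "K \<noteq> 0" using q x by (simp add: K_def)
  have split: "(\<Prod>n<2 * N. 1 + y * q ^ n) = (\<Prod>n<N. 1 + y * q ^ n) * (\<Prod>n<N. 1 + y * q ^ (N + n))"
    by (simp add: mult_2 lessThan_atLeast0 prod.nat_group[symmetric] flip: prod.atLeastLessThan_concat[of 0 N "N + N"])
       (simp add: prod.atLeastLessThan_shift_0[of _ N "N + N"] add.commute)
  have p1: "(\<Prod>n<N. 1 + y * q ^ (N + n)) = (\<Prod>n<N. 1 + x * q ^ n)"
    using q by (intro prod.cong) (simp_all add: y_def power_add power_int_minus field_simps)
  have "(\<Prod>n<N. 1 + y * q ^ n) = (\<Prod>n<N. 1 + x * q powi (- int (Suc n)))"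
  proof (rule prod.reindex_bij_witness[of _ "\<lambda>n. N - Suc n" "\<lambda>n. N - Suc n"])
    fix n assume n: "n \<in> {..<N}"
    have "- int (Suc (N - Suc n)) = - int N + int n" using n by auto
    thus "1 + x * q powi (- int (Suc (N - Suc n))) = 1 + y * q ^ n"
      using q by (subst \<open>- int (Suc (N - Suc n)) = _\<close>, subst power_int_add) (simp_all add: y_def)
  qed auto
  also have "\<dots> = (\<Prod>n<N. x * q powi (- int (Suc n)) * (1 + q ^ Suc n / x))"
  proof (intro prod.cong refl)
    fix n
    have "q powi (- int (Suc n)) * q ^ Suc n = 1" using q
      by (simp only: power_int_minus power_int_of_nat) (simp add: field_simps)
    thus "1 + x * q powi (- int (Suc n)) = x * q powi (- int (Suc n)) * (1 + q ^ Suc n / x)"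
      using x by (simp add: distrib_left)
  qed
  also have "\<dots> = K * (\<Prod>n<N. 1 + q ^ Suc n / x)"
  proof -
    have "(\<Prod>n<N. x * q powi (- int (Suc n))) = K" unfolding K_def
    proof (induction N)
      case (Suc N)
      have "int (Suc N) * (int (Suc N) + 1) div 2 = int N * (int N + 1) div 2 + int (Suc N)"
        using triangle_int_add[of "int N + 1" 1] by (simp add: algebra_simps)
      hence "q powi (- (int (Suc N) * (int (Suc N) + 1) div 2)) = q powi (- (int N * (int N + 1) div 2)) * q powi (- int (Suc N))"
        using q by (subst power_int_add[symmetric]) (simp_all add: algebra_simps)
      thus ?case using Suc by (simp add: algebra_simps)
    qed auto
    thus ?thesis by (simp add: prod.distrib)
  qed
  finally have p2: "(\<Prod>n<N. 1 + y * q ^ n) = K * (\<Prod>n<N. 1 + q ^ Suc n / x)" .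
  have "K * ((\<Prod>n<N. 1 + x * q ^ n) * (\<Prod>n<N. 1 + q ^ Suc n / x)) = (\<Prod>n<2 * N. 1 + y * q ^ n)"
    unfolding split p1 p2 by simp
  also have "\<dots> = (\<Sum>r\<le>2*N. qpoch q (2*N) / (qpoch q r * qpoch q (2*N - r)) * q ^ (r * (r - 1) div 2) * y ^ r)"
    by (rule gauss_binomial[OF q])
  also have "\<dots> = (\<Sum>j\<in>{- int N..int N}. qpoch q (2 * N) / (qpoch q (nat (int N + j)) * qpoch q (nat (int N - j))) * (K * jacobi_term q x j))"
  proof (rule sum.reindex_bij_witness[of _ "\<lambda>j. nat (int N + j)" "\<lambda>r. int r - int N"])
    fix r assume r: "r \<in> {..2*N}"
    define j where "j = int r - int N"
    have 1: "int (r * (r - 1) div 2) = int r * (int r - 1) div 2"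
      by (cases r) (auto simp: zdiv_int algebra_simps)
    have "int r * (int r - 1) div 2 = j * (j - 1) div 2 + int N * (int N - 1) div 2 + j * int N"
      using triangle_int_add[of j "int N"] by (simp add: j_def)
    moreover have "int N * (int N + 1) div 2 = int N * (int N - 1) div 2 + int N"
      using triangle_int_add[of "int N" 1] by (simp add: algebra_simps)
    moreover have "2 * (int N * (int N - 1) div 2) = int N * int N - int N"
      by (subst dvd_mult_div_cancel) (simp_all add: algebra_simps)
    moreover have "(- int N) * int r = - (j * int N) - int N * int N" by (simp add: j_def algebra_simps)
    ultimately have 2: "int (r * (r - 1) div 2) + (- int N) * int r = j * (j - 1) div 2 + - (int N * (int N + 1) div 2)"
      unfolding 1 by linarith
    have "q ^ (r * (r - 1) div 2) * y ^ r = x ^ r * (q powi int (r * (r - 1) div 2) * q powi ((- int N) * int r))"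
      by (simp only: y_def power_mult_distrib power_int_of_nat power_int_mult) simp
    also have "\<dots> = x ^ r * (q powi (j * (j - 1) div 2) * q powi (- (int N * (int N + 1) div 2)))"
      using q arg_cong[OF 2, of "\<lambda>e. q powi e"] by (subst (asm) (1 2) power_int_add) simp_all
    also have "x ^ r = x ^ N * x powi j"
      using x by (simp add: j_def flip: power_int_of_nat power_int_add)
    finally have "q ^ (r * (r - 1) div 2) * y ^ r = K * jacobi_term q x j"
      by (simp add: K_def jacobi_term_def mult_ac)
    moreover have "nat (int N + j) = r" "nat (int N - j) = 2 * N - r" using r by (auto simp: j_def)
    ultimately show "qpoch q (2 * N) / (qpoch q (nat (int N + (int r - int N))) * qpoch q (nat (int N - (int r - int N)))) * (K * jacobi_term q x (int r - int N)) = 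
      qpoch q (2*N) / (qpoch q r * qpoch q (2*N - r)) * q ^ (r * (r - 1) div 2) * y ^ r"
      by (simp add: j_def mult.assoc)
  qed auto
  also have "\<dots> = K * (\<Sum>j\<in>{- int N..int N}. qpoch q (2 * N) / (qpoch q (nat (int N + j)) * qpoch q (nat (int N - j))) * jacobi_term q x j)"
    by (simp add: sum_distrib_left mult_ac)
  finally show ?thesis using K by simp
qed

text \<open>Let \<open>N\<close> grow in the finite form. All q-Pochhammer symbols lie between
  \<open>L\<close> and 1, so the coefficients are bounded by \<open>1 / (L * L)\<close>, and they
  tend to \<open>1 / L\<close>; Tannery's theorem allows the termwise limit. The remaining factor
  \<open>1 / L\<close> is cancelled by the product of the \<open>1 - q ^ Suc n\<close>.\<close>

theorem jacobi_triple_product: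
  fixes q x :: real
  assumes q: "0 < q" "q < 1" and x: "x \<noteq> 0" and summable: "jacobi_term q x summable_on UNIV"
  shows "(\<lambda>N. (\<Prod>n<N. 1 - q ^ Suc n) * (\<Prod>n<N. 1 + x * q ^ n) * (\<Prod>n<N. 1 + q ^ Suc n / x)) \<longlonglongrightarrow>
           (\<Sum>\<^sub>\<infinity>j. jacobi_term q x j)"
proof -
  obtain L where L: "qpoch q \<longlonglongrightarrow> L" "L > 0" "\<And>n. L \<le> qpoch q n" "\<And>n. qpoch q n \<le> 1"
    using qpoch_limit[OF q] by blast
  define c where "c = (\<lambda>N j. if j \<in> {- int N..int N} then qpoch q (2 * N) / (qpoch q (nat (int N + j)) * qpoch q (nat (int N - j))) else 0)"
  have c_bound: "\<bar>c N j\<bar> \<le> 1 / (L * L)" for N j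
  proof -
    have "qpoch q (2 * N) / (qpoch q (nat (int N + j)) * qpoch q (nat (int N - j))) \<le> 1 / (L * L)"
      using L by (intro frac_le mult_mono) (auto intro: less_imp_le order.strict_trans2)
    moreover have "qpoch q n > 0" for n using qpoch_pos q by auto
    ultimately show ?thesis using L(2) by (auto simp: c_def abs_mult abs_of_pos)
  qed
  have c_lim: "(\<lambda>N. c N j) \<longlonglongrightarrow> 1 / L" for j
  proof -
    have "filterlim (\<lambda>N. nat (int N + j)) at_top sequentially"
      unfolding filterlim_at_top
    proof
      fix Z show "\<forall>\<^sub>F N in sequentially. Z \<le> nat (int N + j)"
        using eventually_ge_at_top[of "Z + nat \<bar>j\<bar>"] by eventually_elim linarith
    qed
    moreover have "filterlim (\<lambda>N. nat (int N - j)) at_top sequentially"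
      unfolding filterlim_at_top
    proof
      fix Z show "\<forall>\<^sub>F N in sequentially. Z \<le> nat (int N - j)"
        using eventually_ge_at_top[of "Z + nat \<bar>j\<bar>"] by eventually_elim linarith
    qed
    moreover have "filterlim (\<lambda>N::nat. 2 * N) at_top sequentially"
      by (intro filterlim_subseq) (auto simp: strict_mono_def)
    ultimately have "(\<lambda>N. qpoch q (2 * N) / (qpoch q (nat (int N + j)) * qpoch q (nat (int N - j)))) \<longlonglongrightarrow> L / (L * L)"
      using L(2) by (intro tendsto_divide tendsto_mult filterlim_compose[OF L(1)]) auto
    moreover have "\<forall>\<^sub>F N in sequentially. c N j = qpoch q (2 * N) / (qpoch q (nat (int N + j)) * qpoch q (nat (int N - j)))"
      using eventually_ge_at_top[of "nat \<bar>j\<bar>"] by eventually_elim (auto simp: c_def)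
    ultimately show ?thesis using L(2)
      by (subst tendsto_cong) (auto simp: divide_simps)
  qed
  \<comment> \<open>\<open>int_decode\<close> enumerates the integers, since Tannery's theorem
    concerns series over the natural numbers.\<close>
  have abs_sum: "summable (\<lambda>m. norm (jacobi_term q x (int_decode m)))"
  proof -
    have "(\<lambda>j. norm (jacobi_term q x j)) summable_on UNIV"
      using summable summable_on_iff_abs_summable_on_real by blast
    hence "(\<lambda>m. norm (jacobi_term q x (int_decode m))) summable_on UNIV"
      by (subst summable_on_reindex_bij_betw[OF bij_int_decode])
    thus ?thesis by (rule summable_on_imp_summable)
  qed
  have "(\<lambda>N. \<Sum>m. c N (int_decode m) * jacobi_term q x (int_decode m)) \<longlonglongrightarrow> (\<Sum>m. 1 / L * jacobi_term q x (int_decode m))"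
  proof (rule tannerys_theorem[THEN conjunct2, THEN conjunct2])
    show "\<forall>\<^sub>F (m, N) in sequentially \<times>\<^sub>F sequentially. norm (c N (int_decode m) * jacobi_term q x (int_decode m)) 
       \<le> 1 / (L * L) * norm (jacobi_term q x (int_decode m))"
    proof (intro always_eventually allI, clarify)
      fix m N
      show "norm (c N (int_decode m) * jacobi_term q x (int_decode m)) \<le> 1 / (L * L) * norm (jacobi_term q x (int_decode m))"
        unfolding norm_mult using c_bound by (intro mult_right_mono) auto
    qed
    show "(\<lambda>N. c N (int_decode m) * jacobi_term q x (int_decode m)) \<longlonglongrightarrow> 1 / L * jacobi_term q x (int_decode m)" for m
      by (intro tendsto_mult c_lim tendsto_const)
    show "summable (\<lambda>m. 1 / (L * L) * norm (jacobi_term q x (int_decode m)))"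
      by (intro summable_mult abs_sum)
  qed auto
  moreover have "(\<Sum>m. 1 / L * jacobi_term q x (int_decode m)) = 1 / L * (\<Sum>\<^sub>\<infinity>j. jacobi_term q x j)"
  proof -
    have "(jacobi_term q x has_sum (\<Sum>\<^sub>\<infinity>j. jacobi_term q x j)) UNIV" using summable by simp
    hence "((\<lambda>m. jacobi_term q x (int_decode m)) has_sum (\<Sum>\<^sub>\<infinity>j. jacobi_term q x j)) UNIV"
      by (subst has_sum_reindex_bij_betw[OF bij_int_decode])
    from sums_mult[OF has_sum_imp_sums[OF this], of "1 / L"] show ?thesis by (rule sums_unique[symmetric])
  qed
  moreover have "(\<Sum>m. c N (int_decode m) * jacobi_term q x (int_decode m)) = (\<Prod>n<N. 1 + x * q ^ n) * (\<Prod>n<N. 1 + q ^ Suc n / x)" for N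
  proof -
    have "((\<lambda>j. c N j * jacobi_term q x j) has_sum (\<Sum>j\<in>{- int N..int N}. c N j * jacobi_term q x j)) {- int N..int N}"
      by (rule has_sum_finite) simp
    hence "((\<lambda>j. c N j * jacobi_term q x j) has_sum (\<Sum>j\<in>{- int N..int N}. c N j * jacobi_term q x j)) UNIV"
      by (rule has_sum_cong_neutral[THEN iffD1, rotated 3]) (auto simp: c_def)
    hence "((\<lambda>m. c N (int_decode m) * jacobi_term q x (int_decode m)) has_sum (\<Sum>j\<in>{- int N..int N}. c N j * jacobi_term q x j)) UNIV"
      by (subst has_sum_reindex_bij_betw[OF bij_int_decode])
    hence "(\<Sum>m. c N (int_decode m) * jacobi_term q x (int_decode m)) = (\<Sum>j\<in>{- int N..int N}. c N j * jacobi_term q x j)"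
      using has_sum_imp_sums sums_unique by metis
    also have "\<dots> = (\<Sum>j\<in>{- int N..int N}. qpoch q (2 * N) / (qpoch q (nat (int N + j)) * qpoch q (nat (int N - j))) * jacobi_term q x j)"
      by (intro sum.cong) (auto simp: c_def)
    also have "\<dots> = (\<Prod>n<N. 1 + x * q ^ n) * (\<Prod>n<N. 1 + q ^ Suc n / x)"
      by (rule finite_jacobi[OF q x, symmetric])
    finally show ?thesis .
  qed
  ultimately have "(\<lambda>N. (\<Prod>n<N. 1 + x * q ^ n) * (\<Prod>n<N. 1 + q ^ Suc n / x)) \<longlonglongrightarrow> 1 / L * (\<Sum>\<^sub>\<infinity>j. jacobi_term q x j)"
    by simp
  from tendsto_mult[OF L(1) this] show ?thesis
    using L(2) by (simp add: qpoch_def mult.assoc)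
qed

section \<open>Inversion of theta series\<close>

text \<open>A Jacobi theta series with characteristic on the imaginary axis, normalised by complete
  squares so that Poisson summation for Gaussians applies to it directly.\<close>

definition alt_theta :: "real \<Rightarrow> real \<Rightarrow> complex" where
  "alt_theta s u = (\<Sum>\<^sub>\<infinity>n::int. (- 1) powi n * of_real (exp (- (pi * s * (of_int n + u)\<^sup>2))))"

lemma minus_one_powi_uminus: "(- 1 :: complex) powi (- n) = (- 1) powi n"
  by (simp add: power_int_minus_one_minus)

lemma alt_theta_minus: "alt_theta s (- u) = alt_theta s u"
  unfolding alt_theta_def
proof (rule infsum_reindex_bij_witness[of UNIV uminus uminus])
  fix n :: int
  have "(of_int (- n) + u)\<^sup>2 = (of_int n + - u)\<^sup>2" by (simp add: power2_eq_square algebra_simps)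
  thus "(- 1) powi - n * complex_of_real (exp (- (pi * s * (real_of_int (- n) + u)\<^sup>2))) =
         (- 1) powi n * complex_of_real (exp (- (pi * s * (real_of_int n + - u)\<^sup>2)))"
    by (simp only: minus_one_powi_uminus)
qed auto

lemma alt_theta_plus_1: "alt_theta s (u + 1) = - alt_theta s u"
proof -
  have "alt_theta s (u + 1) = (\<Sum>\<^sub>\<infinity>n::int. - ((- 1) powi n * of_real (exp (- (pi * s * (of_int n + u)\<^sup>2)))))"
    unfolding alt_theta_def
  proof (rule infsum_reindex_bij_witness[of UNIV "\<lambda>n. n - 1" "\<lambda>n. n + 1"])
    fix n :: int
    show "- ((- 1) powi (n + 1) * complex_of_real (exp (- (pi * s * (real_of_int (n + 1) + u)\<^sup>2)))) =
         (- 1) powi n * complex_of_real (exp (- (pi * s * (real_of_int n + (u + 1))\<^sup>2)))"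
      by (simp add: power_int_add algebra_simps)
  qed auto
  thus ?thesis by (simp add: alt_theta_def infsum_uminus)
qed

text \<open>Evenness and antiperiodicity combine into an odd reflection about 1/2. It folds the
  \<open>2 * k + 1\<close> residue classes of the inversion formula into \<open>k\<close> pairs and
  makes the middle class vanish.\<close>

lemma alt_theta_one_minus: "alt_theta s (1 - u) = - alt_theta s u"
  using alt_theta_plus_1[of s "- u"] by (simp add: alt_theta_minus)

lemma bij_betw_div_mod:
  assumes "(p::int) > 0"
  shows "bij_betw (\<lambda>(r, l). p * l + r) ({0..<p} \<times> UNIV) UNIV"
  by (rule bij_betw_byWitness[where f' = "\<lambda>n. (n mod p, n div p)"]) (use assms in auto)

lemma cis_pi_int: "cis (pi * of_int n) = (- 1) powi n"
proof -
  have "cis (pi * of_int n) = cis pi powi n" by (simp add: cis_power_int mult.commute del: cis_pi)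
  thus ?thesis by simp
qed

text \<open>Poisson summation produces a theta series over half-integers with a phase of period
  related to \<open>p\<close>. Sorting its index by residues modulo \<open>p = 2 * k + 1\<close>
  gives series of scale \<open>p * t\<close>, and pairing \<open>r\<close> with
  \<open>2 * k - r\<close> leaves \<open>k\<close> of them.\<close>

theorem alt_theta_inversion:
  fixes k i :: nat and t :: real
  assumes t: "t > 0"
  defines "p \<equiv> 2 * real k + 1"
  defines "b \<equiv> \<lambda>j::nat. 1 / 2 - real j / p"
  defines "C \<equiv> \<lambda>r. cis (- (2 * pi * b i * (real r + 1 / 2)))"
  shows "alt_theta (p / t) (b i) = of_real (sqrt (t / p)) *
     (\<Sum>j<k. (C (k - Suc j) - C (2 * k - (k - Suc j))) * alt_theta (p * t) (b (Suc j)))"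
proof -
  have p: "p > 0" by (simp add: p_def)
  define P where "P = 2 * int k + 1"
  have P: "P > 0" "of_int P = p" by (simp_all add: P_def p_def)
  \<comment> \<open>The alternating sign is the character \<open>cis (pi * m)\<close>, so
    \<open>alt_theta\<close> is the dual side of Poisson summation with shift 1/2, and
    \<open>h\<close> is the original side.\<close>
  define h where "h = (\<lambda>n::int. complex_of_real (exp (- (pi * (t / p) * (of_int n + 1/2)\<^sup>2))) * cis (2 * pi * (- b i) * (of_int n + 1/2)))"
  have "(\<Sum>\<^sub>\<infinity>n. h n) = of_real (1 / sqrt (t / p)) * alt_theta (p / t) (b i)"
    using poisson_gaussian[of "t / p" "1/2" "- b i"] t p unfolding h_def alt_theta_def
    by (simp add: cis_pi_int[symmetric] mult_ac)
  hence 1: "alt_theta (p / t) (b i) = of_real (sqrt (t / p)) * (\<Sum>\<^sub>\<infinity>n. h n)"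
    using t p by simp
  have summ: "h summable_on UNIV"
  proof (rule abs_summable_summable, rule summable_on_comparison_test)
    show "(\<lambda>n::int. exp (pi * (t/p) * (1/2)\<^sup>2) * exp (- (pi * (t/p) / 2)) ^ nat \<bar>n\<bar>) summable_on UNIV"
      by (rule gaussian_bound_summable) (use t p in auto)
    show "norm (h n) \<le> exp (pi * (t/p) * (1/2)\<^sup>2) * exp (- (pi * (t/p) / 2)) ^ nat \<bar>n\<bar>" for n
      using gaussian_shift_le[of "t/p" "1/2" "1/2" n] t p by (simp add: h_def norm_mult)
  qed auto
  define u where "u = (\<lambda>r::nat. (2 * real r + 1) / (2 * p))"
  have h_eq: "h (P * l + int r) = C r * ((- 1) powi l * complex_of_real (exp (- (pi * (p * t) * (of_int l + u r)\<^sup>2))))" for l r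
  proof -
    have "of_int (P * l + int r) + 1 / 2 = p * (of_int l + u r)"
      using p by (simp add: u_def P field_simps)
    hence "pi * (t / p) * (of_int (P * l + int r) + 1 / 2)\<^sup>2 = pi * (p * t) * (of_int l + u r)\<^sup>2"
      using p by (simp only: power_mult_distrib) (simp add: power2_eq_square)
    \<comment> \<open>\<open>2 * b i * p\<close> is the odd integer \<open>P - 2 * int i\<close>, so
      each full step of \<open>P\<close> in the index changes the sign of the phase. This makes
      every residue class again an alternating series.\<close>
    moreover have "cis (2 * pi * (- b i) * (of_int (P * l + int r) + 1/2)) = C r * (- 1) powi l"
    proof -
      have "2 * b i * p = of_int (P - 2 * int i)" using p by (simp add: b_def P left_diff_distrib)
      moreover have "2 * pi * (- b i) * (of_int (P * l + int r) + 1/2) = - (2 * pi * b i * (real r + 1 / 2)) - pi * of_int l * (2 * b i * p)"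
        by (simp add: P algebra_simps)
      ultimately have "2 * pi * (- b i) * (of_int (P * l + int r) + 1/2) = - (2 * pi * b i * (real r + 1 / 2)) + pi * of_int (- ((P - 2 * int i) * l))"
        by (simp only: of_int_minus of_int_mult) simp
      moreover have "cis (pi * of_int (- ((P - 2 * int i) * l))) = (- 1) powi l"
        unfolding cis_pi_int minus_one_powi_uminus
        by (cases "even l") (auto simp: P_def power_int_minus_left)
      ultimately show ?thesis by (simp only: C_def cis_mult[symmetric])
    qed
    ultimately show ?thesis by (simp only: h_def mult_ac)
  qed
  have "(\<Sum>\<^sub>\<infinity>n. h n) = (\<Sum>\<^sub>\<infinity>(r, l)\<in>{0..<P} \<times> UNIV. h (P * l + r))"
    using infsum_reindex_bij_betw[OF bij_betw_div_mod[OF P(1)], of h] by (simp add: case_prod_unfold)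
  also have "\<dots> = (\<Sum>\<^sub>\<infinity>r\<in>{0..<P}. \<Sum>\<^sub>\<infinity>l. h (P * l + r))"
  proof (subst infsum_Sigma'_banach[symmetric])
    show "(\<lambda>(r, l). h (P * l + r)) summable_on {0..<P} \<times> UNIV"
      using summable_on_reindex_bij_betw[OF bij_betw_div_mod[OF P(1)], of h] summ by (simp add: case_prod_unfold)
  qed simp
  also have "\<dots> = (\<Sum>r\<in>{0..<P}. \<Sum>\<^sub>\<infinity>l. h (P * l + r))" by simp
  also have "\<dots> = (\<Sum>r<2*k+1. \<Sum>\<^sub>\<infinity>l. h (P * l + int r))"
    by (rule sum.reindex_bij_witness[of _ int nat]) (auto simp: P_def)
  also have "\<dots> = (\<Sum>r<2*k+1. C r * alt_theta (p * t) (u r))"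
    unfolding h_eq alt_theta_def by (simp add: infsum_cmult_right')
  also have "\<dots> = (\<Sum>r<k. C r * alt_theta (p * t) (u r)) + C k * alt_theta (p * t) (u k) + (\<Sum>r\<in>{k<..<2*k+1}. C r * alt_theta (p * t) (u r))"
  proof -
    have "{..<2*k+1} = insert k ({..<k} \<union> {k<..<2*k+1})" by auto
    moreover have "{..<k} \<inter> {k<..<2*k+1} = {}" by auto
    ultimately show ?thesis by (simp add: sum.union_disjoint)
  qed
  also have "u k = 1 / 2" using p by (simp add: u_def p_def field_simps)
  also have "alt_theta (p * t) (1 / 2) = 0"
    using alt_theta_one_minus[of "p * t" "1/2"] by simp
  also have "(\<Sum>r\<in>{k<..<2*k+1}. C r * alt_theta (p * t) (u r)) = (\<Sum>r<k. - C (2 * k - r) * alt_theta (p * t) (u r))"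
  proof (rule sum.reindex_bij_witness[of _ "\<lambda>r. 2 * k - r" "\<lambda>r. 2 * k - r"])
    fix r assume r: "r \<in> {k<..<2*k+1}"
    have "u (2 * k - r) = 1 - u r" using p r by (simp add: u_def p_def field_simps of_nat_diff)
    thus "- C (2 * k - (2 * k - r)) * alt_theta (p * t) (u (2 * k - r)) = C r * alt_theta (p * t) (u r)"
      using r by (simp add: alt_theta_one_minus)
  qed auto
  also have "(\<Sum>r<k. C r * alt_theta (p * t) (u r)) + C k * 0 + (\<Sum>r<k. - C (2 * k - r) * alt_theta (p * t) (u r)) =
     (\<Sum>r<k. (C r - C (2 * k - r)) * alt_theta (p * t) (u r))"
    by (simp add: sum_subtractf sum_negf algebra_simps)
  \<comment> \<open>The shifts \<open>u r\<close> with \<open>r < k\<close> are the numbers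
    \<open>b 1\<close>, ..., \<open>b k\<close> in reverse order, so the same family of theta series
    returns.\<close>
  also have "\<dots> = (\<Sum>j<k. (C (k - Suc j) - C (2 * k - (k - Suc j))) * alt_theta (p * t) (b (Suc j)))"
  proof (rule sum.reindex_bij_witness[of _ "\<lambda>r. k - Suc r" "\<lambda>r. k - Suc r"])
    fix r assume r: "r \<in> {..<k}"
    have "k - Suc (k - Suc r) = r" using r by auto
    moreover have "b (Suc (k - Suc r)) = u r" using p r by (simp add: b_def u_def p_def field_simps of_nat_diff)
    ultimately show "(C (k - Suc (k - Suc r)) - C (2 * k - (k - Suc (k - Suc r)))) * alt_theta (p * t) (b (Suc (k - Suc r))) = (C r - C (2 * k - r)) * alt_theta (p * t) (u r)"
      by simp
  qed auto
  finally show ?thesis using 1 by simp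
qed

section \<open>Product and theta expansions of the characters\<close>

text \<open>Selecting the factors by a predicate lets eta, the characters and the theta products
  share convergence, non-vanishing and holomorphy.\<close>

definition euler_prod :: "(nat \<Rightarrow> bool) \<Rightarrow> complex \<Rightarrow> complex" where
  "euler_prod c q = (\<Prod>n. if c n then 1 - q ^ n else 1)"

lemma euler_prod_convergent:
  fixes q :: complex and c :: "nat \<Rightarrow> bool"
  assumes "norm q < 1" "\<not> c 0"
  shows "convergent_prod (\<lambda>n. if c n then 1 - q ^ n else 1)"
proof -
  have "summable (\<lambda>n. norm ((if c n then 1 - q ^ n else 1) - 1))"
    by (rule summable_comparison_test[of _ "\<lambda>n. norm q ^ n"])
       (use assms in \<open>auto simp: norm_power summable_geometric\<close>)
  thus ?thesis
    by (intro abs_convergent_prod_imp_convergent_prod summable_imp_abs_convergent_prod)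
qed

lemma euler_prod_nonzero:
  assumes "norm q < 1" "\<not> c 0"
  shows "euler_prod c q \<noteq> 0"
  unfolding euler_prod_def
proof (rule prodinf_nonzero)
  show "convergent_prod (\<lambda>n. if c n then 1 - q ^ n else 1)"
    using assms by (rule euler_prod_convergent)
  fix n
  have "q ^ n \<noteq> 1" if "c n"
  proof
    assume "q ^ n = 1"
    hence "norm q ^ n = 1" by (metis norm_one norm_power)
    moreover have "n > 0" using that assms(2) by (cases n) auto
    ultimately show False using assms(1) by (metis norm_ge_zero power_less_one_iff less_irrefl)
  qed
  thus "(if c n then 1 - q ^ n else 1) \<noteq> 0" by auto
qed

lemma euler_prod_0 [simp]: "\<not> c 0 \<Longrightarrow> euler_prod c 0 = 1"
proof -
  assume "\<not> c 0"
  hence "(\<lambda>n. if c n then 1 - 0 ^ n else 1) = (\<lambda>_. 1 :: complex)" by (intro ext) (auto simp: power_0_left)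
  thus ?thesis by (simp add: euler_prod_def)
qed

lemma euler_prod_holomorphic:
  assumes "\<not> c 0"
  shows "euler_prod c holomorphic_on ball 0 1"
proof (rule holomorphic_uniform_sequence)
  define f where "f = (\<lambda>n q. if c n then 1 - q ^ n else (1 :: complex))"
  show "(\<lambda>q. \<Prod>n<N. f n q) holomorphic_on ball 0 1" for N
  proof (rule holomorphic_on_prod)
    show "f n holomorphic_on ball 0 1" for n
      by (cases "c n") (auto simp: f_def intro!: holomorphic_intros)
  qed
  fix x :: complex assume x: "x \<in> ball 0 1"
  define d where "d = (1 - norm x) / 2"
  define r where "r = (1 + norm x) / 2"
  have r: "0 \<le> r" "r < 1" "0 < d" using x by (auto simp: r_def d_def)
  have sub: "norm q \<le> r" if "q \<in> cball x d" for q
    using that norm_triangle_sub[of q x] by (simp add: r_def d_def dist_norm norm_minus_commute)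
  have "uniformly_convergent_on (cball x d) (\<lambda>N q. \<Sum>n<N. norm (f n q - 1))"
  proof (rule Weierstrass_m_test')
    fix n q assume "q \<in> cball x d"
    thus "norm (norm (f n q - 1)) \<le> r ^ n"
      using sub[of q] r by (auto simp: f_def norm_power intro!: power_mono)
  qed (use r in \<open>simp add: summable_geometric\<close>)
  hence "uniformly_convergent_on (cball x d) (\<lambda>N q. \<Prod>n<N. f n q)"
  proof (intro uniformly_convergent_on_prod')
    show "continuous_on (cball x d) (f n)" for n
      by (cases "c n") (auto simp: f_def intro!: continuous_intros)
  qed auto
  hence "uniform_limit (cball x d) (\<lambda>N q. \<Prod>n<N. f n q) (\<lambda>q. lim (\<lambda>N. \<Prod>n<N. f n q)) sequentially"
    by (simp add: uniformly_convergent_uniform_limit_iff)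
  also have "?this \<longleftrightarrow> uniform_limit (cball x d) (\<lambda>N q. \<Prod>n<N. f n q) (euler_prod c) sequentially"
  proof (intro uniform_limit_cong' refl)
    fix q assume "q \<in> cball x d"
    hence "norm q < 1" using sub[of q] r by simp
    from convergent_prod_LIMSEQ[OF euler_prod_convergent[of q c, OF this assms]]
    have "(\<lambda>N. \<Prod>n<Suc N. f n q) \<longlonglongrightarrow> euler_prod c q"
      by (simp add: euler_prod_def f_def lessThan_Suc_atMost)
    thus "lim (\<lambda>N. \<Prod>n<N. f n q) = euler_prod c q" by (intro limI) (rule LIMSEQ_imp_Suc)
  qed
  finally show "\<exists>d>0. cball x d \<subseteq> ball 0 1 \<and> uniform_limit (cball x d) (\<lambda>N q. \<Prod>n<N. f n q) (euler_prod c) sequentially"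
    using r sub by (intro exI[of _ d]) (fastforce simp: subset_iff)
qed simp

lemma euler_prod_mult:
  assumes "norm q < 1" "\<not> c 0" "\<not> d 0" "\<And>n. \<not> (c n \<and> d n)"
  shows "euler_prod c q * euler_prod d q = euler_prod (\<lambda>n. c n \<or> d n) q"
  unfolding euler_prod_def using assms
  by (subst prodinf_mult[OF euler_prod_convergent euler_prod_convergent]) (auto intro!: prodinf_cong)

section \<open>Characters and eta in terms of the nome\<close>

definition nome :: "complex \<Rightarrow> complex" where
  "nome z = exp (2 * of_real pi * \<i> * z)"

lemma norm_nome: "norm (nome z) = exp (- (2 * pi * Im z))"
  by (simp add: nome_def)

lemma norm_nome_less_1: "z \<in> \<H> \<Longrightarrow> norm (nome z) < 1"
  by (simp add: norm_nome upper_half_plane_def)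

lemma qpow_of_nat: "qpow (of_nat n) z = nome z ^ n"
  by (simp add: qpow_def nome_def flip: exp_of_nat_mult) (simp add: mult_ac)

lemma qpow_add: "qpow (a + b) z = qpow a z * qpow b z"
  by (simp add: qpow_def of_rat_add distrib_left distrib_right exp_add)

lemma qpow_nonzero [simp]: "qpow a z \<noteq> 0"
  by (simp add: qpow_def)

definition ch_index :: "nat \<Rightarrow> nat \<Rightarrow> nat \<Rightarrow> bool" where
  "ch_index i k n \<longleftrightarrow> n \<ge> 1 \<and> \<not> [int n = 0] (mod (2 * int k + 1))
                 \<and> \<not> [int n = int i] (mod (2 * int k + 1))
                 \<and> \<not> [int n = - int i] (mod (2 * int k + 1))"

text \<open>Multiplying a character by eta cancels its denominator and leaves the factors with these
  indices; they are the ones of a triple product with base \<open>q ^ (2 * k + 1)\<close>.\<close>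

definition theta_index :: "nat \<Rightarrow> nat \<Rightarrow> nat \<Rightarrow> bool" where
  "theta_index i k n \<longleftrightarrow> n \<ge> 1 \<and> \<not> ch_index i k n"

definition ch_exponent :: "nat \<Rightarrow> nat \<Rightarrow> rat" where
  "ch_exponent i k = conf_weight i k - central_charge k / 24"

lemma ch_index_0 [simp]: "\<not> ch_index i k 0" "\<not> theta_index i k 0"
  by (auto simp: ch_index_def theta_index_def)

lemma ch_eq:
  assumes "z \<in> \<H>"
  shows "ch i k z = qpow (ch_exponent i k) z * inverse (euler_prod (ch_index i k) (nome z))"
proof -
  have "inverse (euler_prod (ch_index i k) (nome z)) = (\<Prod>n. inverse (if ch_index i k n then 1 - nome z ^ n else 1))"
    unfolding euler_prod_def using assms
    by (subst prodinf_inverse) (auto intro!: euler_prod_convergent norm_nome_less_1)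
  also have "\<dots> = (\<Prod>n. if ch_index i k n then 1 / (1 - qpow (of_nat n) z) else 1)"
    by (intro prodinf_cong) (simp add: qpow_of_nat divide_inverse)
  finally show ?thesis by (simp add: ch_def ch_exponent_def ch_index_def)
qed

definition dedekind_eta :: "complex \<Rightarrow> complex" where
  "dedekind_eta z = qpow (1 / 24) z * euler_prod (\<lambda>n. n \<ge> 1) (nome z)"

text \<open>The squares of \<open>2 * k - 1\<close> in the conformal weight and in the central
  charge cancel. The remaining square is the one that appears on completing the square in the theta
  series, and the 1/24 is the leading exponent of eta.\<close>

lemma ch_exponent_eq:
  assumes "i \<le> k"
  shows "ch_exponent i k = (2 * of_nat k + 1 - 2 * of_nat i)\<^sup>2 / (8 * (2 * of_nat k + 1)) - 1 / 24"
proof -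
  have "(2 * of_nat k + 1 :: rat) \<noteq> 0" by (metis of_nat_1 of_nat_add of_nat_mult of_nat_numeral of_nat_eq_0_iff add_is_0 one_neq_zero)
  hence nz: "D \<noteq> 0" if "D = (2 * of_nat k + 1 :: rat)" for D using that by simp
  have "(A - B) / (8 * D) - (1 - 3 * B / D) / 24 = A / (8 * D) - 1 / 24" if "D \<noteq> 0" for A B D :: rat
    using that by (simp add: divide_simps)
  from this[OF nz[OF refl]] show ?thesis
    unfolding ch_exponent_def conf_weight_def central_charge_def
    using assms by (simp add: algebra_simps)
qed

lemma eta_mult_ch:
  assumes "z \<in> \<H>"
  shows "dedekind_eta z * ch i k z = qpow (1 / 24 + ch_exponent i k) z * euler_prod (theta_index i k) (nome z)"
proof -
  have q: "norm (nome z) < 1" by (rule norm_nome_less_1[OF assms])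
  have "euler_prod (ch_index i k) (nome z) * euler_prod (theta_index i k) (nome z) = euler_prod (\<lambda>n. ch_index i k n \<or> theta_index i k n) (nome z)"
    using q by (intro euler_prod_mult) (auto simp: theta_index_def)
  also have "(\<lambda>n. ch_index i k n \<or> theta_index i k n) = (\<lambda>n. n \<ge> 1)"
    by (auto simp: theta_index_def ch_index_def)
  finally have "euler_prod (\<lambda>n. n \<ge> 1) (nome z) = euler_prod (ch_index i k) (nome z) * euler_prod (theta_index i k) (nome z)" ..
  moreover have "euler_prod (ch_index i k) (nome z) \<noteq> 0" using q by (intro euler_prod_nonzero) auto
  ultimately show ?thesis using assms
    by (simp add: dedekind_eta_def ch_eq qpow_add)
qed

text \<open>Blocks run from 1 to \<open>2 * k + 1\<close> rather than from 0, so that a multiple of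
  the modulus closes its block and the index 0, which carries no factor, is left out.\<close>

lemma theta_index_block:
  assumes i: "1 \<le> i" "i \<le> k" and r: "1 \<le> r" "r \<le> 2 * k + 1"
  shows "theta_index i k ((2 * k + 1) * N + r) \<longleftrightarrow> r = i \<or> r = 2 * k + 1 - i \<or> r = 2 * k + 1"
proof -
  define p where "p = 2 * int k + 1"
  have m: "[int ((2 * k + 1) * N + r) = x] (mod p) \<longleftrightarrow> int r mod p = x mod p" for x
  proof -
    have "int ((2 * k + 1) * N + r) = int r + int N * p" by (simp add: p_def algebra_simps)
    thus ?thesis by (simp add: cong_def)
  qed
  have "int r mod p = (if r = 2 * k + 1 then 0 else int r)"
    using r by (auto simp: p_def add.commute)
  moreover have "int i mod p = int i" using i by (simp add: p_def)
  moreover have "(- int i) mod p = p - int i"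
    using i by (simp add: zmod_zminus1_eq_if p_def)
  ultimately show ?thesis using r i
    unfolding theta_index_def ch_index_def p_def[symmetric] m by (auto simp: p_def)
qed

text \<open>Each block contributes exactly three factors, one to each product of the triple product
  with base \<open>q ^ p\<close> and argument \<open>- (q ^ i)\<close>.\<close>

lemma theta_index_partial_prod:
  fixes q :: real
  assumes i: "1 \<le> i" "i \<le> k" and q: "q \<noteq> 0"
  defines "p \<equiv> 2 * k + 1"
  shows "(\<Prod>n<p * N + 1. if theta_index i k n then 1 - q ^ n else 1) =
    (\<Prod>n<N. 1 - (q ^ p) ^ Suc n) * (\<Prod>n<N. 1 + (- (q ^ i)) * (q ^ p) ^ n) * (\<Prod>n<N. 1 + (q ^ p) ^ Suc n / (- (q ^ i)))"
proof (induction N)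
  case 0
  thus ?case by simp
next
  case (Suc N)
  define f where "f = (\<lambda>n. if theta_index i k n then 1 - q ^ n else 1)"
  have un: "{..<p * Suc N + 1} = {..<p * N + 1} \<union> (\<lambda>r. p * N + r) ` {1..p}"
  proof (intro equalityI subsetI)
    fix n assume n: "n \<in> {..<p * Suc N + 1}"
    show "n \<in> {..<p * N + 1} \<union> (\<lambda>r. p * N + r) ` {1..p}"
    proof (cases "n < p * N + 1")
      case False
      hence "n = p * N + (n - p * N)" "n - p * N \<in> {1..p}" using n by auto
      thus ?thesis by blast
    qed auto
  qed auto
  have "prod f {..<p * Suc N + 1} = prod f {..<p * N + 1} * prod f ((\<lambda>r. p * N + r) ` {1..p})"
    unfolding un by (rule prod.union_disjoint) auto
  also have "prod f ((\<lambda>r. p * N + r) ` {1..p}) = (\<Prod>r\<in>{1..p}. f (p * N + r))"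
    by (subst prod.reindex) (auto simp: inj_on_def)
  also have "\<dots> = (\<Prod>r\<in>{i, p - i, p}. f (p * N + r))"
  proof (rule prod.mono_neutral_right)
    show "{i, p - i, p} \<subseteq> {1..p}" using i by (auto simp: p_def)
    show "\<forall>r\<in>{1..p} - {i, p - i, p}. f (p * N + r) = 1"
      using theta_index_block[OF i, of _ N] unfolding f_def p_def by fastforce
  qed simp
  also have "\<dots> = (\<Prod>r\<in>{i, p - i, p}. 1 - q ^ (p * N + r))"
  proof (rule prod.cong)
    fix r assume "r \<in> {i, p - i, p}"
    moreover from this have "1 \<le> r" "r \<le> 2 * k + 1" using i by (auto simp: p_def)
    ultimately show "f (p * N + r) = 1 - q ^ (p * N + r)"
      using theta_index_block[OF i, of r N] unfolding f_def p_def by simp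
  qed simp
  also have "\<dots> = (1 - q ^ (p * N + i)) * ((1 - q ^ (p * N + (p - i))) * (1 - q ^ (p * N + p)))"
  proof -
    have "i \<noteq> p - i" "i \<noteq> p" "p - i \<noteq> p" using i by (auto simp: p_def)
    thus ?thesis by simp
  qed
  also have "1 - q ^ (p * N + i) = 1 + (- (q ^ i)) * (q ^ p) ^ N"
    by (simp add: power_add power_mult mult.commute[of "q ^ i"])
  also have "1 - q ^ (p * N + p) = 1 - (q ^ p) ^ Suc N"
    by (simp add: power_add power_mult mult.commute[of "q ^ p"])
  also have "1 - q ^ (p * N + (p - i)) = 1 + (q ^ p) ^ Suc N / (- (q ^ i))"
  proof -
    have "p * N + (p - i) + i = p * Suc N" using i by (simp add: p_def)
    hence "(q ^ p) ^ Suc N = q ^ (p * N + (p - i)) * q ^ i"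
      by (metis power_add power_mult)
    thus ?thesis using q by simp
  qed
  finally show ?case unfolding Suc.IH[folded f_def] f_def[symmetric] prod.lessThan_Suc
    by (simp only: mult_ac)
qed

lemma theta_index_tendsto:
  fixes q :: real
  assumes "1 \<le> i" "i \<le> k" and q: "0 < q" "q < 1"
  shows "(\<lambda>N. complex_of_real (\<Prod>n<(2 * k + 1) * N + 1. if theta_index i k n then 1 - q ^ n else 1)) \<longlonglongrightarrow> 
     euler_prod (theta_index i k) (of_real q)"
proof -
  have "(\<lambda>N. \<Prod>n\<le>N. if theta_index i k n then 1 - complex_of_real q ^ n else 1) \<longlonglongrightarrow> euler_prod (theta_index i k) (of_real q)"
    unfolding euler_prod_def using q by (intro convergent_prod_LIMSEQ euler_prod_convergent) auto
  moreover have "filterlim (\<lambda>N. (2 * k + 1) * N) at_top sequentially"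
    by (intro filterlim_subseq strict_monoI mult_less_mono2) auto
  ultimately have "(\<lambda>N. \<Prod>n\<le>(2 * k + 1) * N. if theta_index i k n then 1 - complex_of_real q ^ n else 1) \<longlonglongrightarrow> euler_prod (theta_index i k) (of_real q)"
    by (rule filterlim_compose)
  moreover have "(\<Prod>n\<le>M. if theta_index i k n then 1 - complex_of_real q ^ n else 1) = 
      complex_of_real (\<Prod>n<M + 1. if theta_index i k n then 1 - q ^ n else 1)" for M
    by (simp add: lessThan_Suc_atMost if_distrib[of of_real] cong: if_cong)
  ultimately show ?thesis by simp
qed

text \<open>Here \<open>q\<close> is real and the triple product applies. Completing the square in
  its exponents produces the constant \<open>c\<close>, which the leading power of \<open>q\<close>
  cancels.\<close>

theorem eta_mult_ch_imag_axis:
  fixes t :: real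
  assumes i: "1 \<le> i" "i \<le> k" and t: "t > 0"
  shows "dedekind_eta (\<i> * t) * ch i k (\<i> * t) = alt_theta ((2 * real k + 1) * t) (1 / 2 - real i / (2 * real k + 1))"
proof -
  define p where "p = 2 * k + 1"
  define q where "q = exp (- (2 * pi * t))"
  define b where "b = 1 / 2 - real i / real p"
  define c where "c = exp (pi * (p * t) * b\<^sup>2)"
  have q: "0 < q" "q < 1" using t by (auto simp: q_def)
  have p: "p > 0" "real p = 2 * real k + 1" by (auto simp: p_def)
  have Q: "0 < q ^ p" "q ^ p < 1" using q p by (auto simp: power_less_one_iff)
  \<comment> \<open>The square is completed by \<open>p * j * (j - 1) / 2 + i * j = p * (j - b)^2 /
    2 - p * b^2 / 2\<close>, which determines \<open>b = 1 / 2 - i / p\<close>.\<close>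
  have jt: "jacobi_term (q ^ p) (- (q ^ i)) j = (- 1) powi j * (c * exp (- (pi * (p * t) * (of_int j + - b)\<^sup>2)))" for j
  proof -
    have qpi: "q powi m = exp (- (2 * pi * t * of_int m))" for m
      by (simp add: q_def exp_power_int mult_ac)
    have "of_int (j * (j - 1) div 2) = of_int (j * (j - 1)) / (2 :: real)"
      using real_of_int_div[of 2 "j * (j - 1)"] by simp
    hence e: "- (2 * pi * t * (p * of_int (j * (j - 1) div 2) + i * of_int j)) = pi * (p * t) * b\<^sup>2 + - (pi * (p * t) * (of_int j + - b)\<^sup>2)"
    proof -
      have pb: "real p * (b * 2) = real p - 2 * real i" using p(1) by (simp add: b_def right_diff_distrib)
      have "pi * (p * t) * b\<^sup>2 + - (pi * (p * t) * (of_int j + - b)\<^sup>2) = pi * t * of_int j * (p * (b * 2) - p * of_int j)"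
        by (simp add: power2_eq_square algebra_simps)
      also have "\<dots> = - (2 * pi * t * (p * (of_int (j * (j - 1)) / 2) + i * of_int j))"
        unfolding pb by (simp add: field_simps)
      finally show ?thesis using \<open>of_int (j * (j - 1) div 2) = _\<close> by simp
    qed
    have "jacobi_term (q ^ p) (- (q ^ i)) j = (- 1) powi j * (q powi (int p * (j * (j - 1) div 2)) * q powi (int i * j))"
    proof -
      have "- (q ^ i) = (- 1) * q powi int i" "q ^ p = q powi int p" by simp_all
      thus ?thesis unfolding jacobi_term_def by (simp only: power_int_mult_distrib power_int_mult) (simp add: mult_ac)
    qed
    also have "q powi (int p * (j * (j - 1) div 2)) * q powi (int i * j) = exp (- (2 * pi * t * (p * of_int (j * (j - 1) div 2) + i * of_int j)))"
      by (simp add: qpi algebra_simps flip: exp_add)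
    finally show ?thesis unfolding e exp_add c_def .
  qed
  have summ: "jacobi_term (q ^ p) (- (q ^ i)) summable_on UNIV"
  proof (subst summable_on_iff_abs_summable_on_real, rule summable_on_comparison_test)
    show "(\<lambda>n::int. c * (exp (pi * (p * t) * \<bar>b\<bar>\<^sup>2) * exp (- (pi * (p * t) / 2)) ^ nat \<bar>n\<bar>)) summable_on UNIV"
      by (intro summable_on_cmult_right gaussian_bound_summable) (use t p in auto)
    show "norm (jacobi_term (q ^ p) (- (q ^ i)) n) \<le> c * (exp (pi * (p * t) * \<bar>b\<bar>\<^sup>2) * exp (- (pi * (p * t) / 2)) ^ nat \<bar>n\<bar>)" for n
    proof -
      have "c > 0" by (simp add: c_def)
      thus ?thesis unfolding jt
        using gaussian_shift_le[of "p * t" "- b" "\<bar>b\<bar>" n] t p(1) by (simp add: abs_mult power_int_abs)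
    qed
  qed auto
  have "(\<lambda>N. complex_of_real (\<Prod>n<p * N + 1. if theta_index i k n then 1 - q ^ n else 1)) \<longlonglongrightarrow> of_real (\<Sum>\<^sub>\<infinity>j. jacobi_term (q ^ p) (- (q ^ i)) j)"
    unfolding p_def theta_index_partial_prod[OF i less_imp_neq[OF q(1), symmetric]] 
    using jacobi_triple_product[OF Q, of "- (q ^ i)"] q summ by (intro tendsto_of_real) (simp add: p_def)
  hence "euler_prod (theta_index i k) (of_real q) = of_real (\<Sum>\<^sub>\<infinity>j. jacobi_term (q ^ p) (- (q ^ i)) j)"
    using LIMSEQ_unique theta_index_tendsto[OF i q] unfolding p_def by blast
  also have "\<dots> = (\<Sum>\<^sub>\<infinity>j. of_real c * ((- 1) powi j * of_real (exp (- (pi * (p * t) * (of_int j + - b)\<^sup>2)))))"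
  proof -
    have "complex_of_real (jacobi_term (q ^ p) (- (q ^ i)) j) = of_real c * ((- 1) powi j * of_real (exp (- (pi * (p * t) * (of_int j + - b)\<^sup>2))))" for j
      by (simp add: jt)
    thus ?thesis using infsumI[OF has_sum_of_real[OF has_sum_infsum[OF summ]], where ?'a1 = complex] by (simp only:)
  qed
  also have "\<dots> = of_real c * alt_theta (p * t) b"
    using alt_theta_minus[of "p * t" b] by (simp only: infsum_cmult_right' alt_theta_def)
  finally have 1: "euler_prod (theta_index i k) (of_real q) = of_real c * alt_theta (p * t) b" .
  have z: "\<i> * t \<in> \<H>" using t by (simp add: upper_half_plane_def)
  have 2: "nome (\<i> * t) = of_real q"
    by (simp add: nome_def q_def mult_ac flip: exp_of_real)
  have "1 / 24 + ch_exponent i k = (2 * of_nat k + 1 - 2 * of_nat i)\<^sup>2 / (8 * (2 * of_nat k + 1))"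
    using ch_exponent_eq[OF i(2)] by simp
  hence "complex_of_rat (1 / 24 + ch_exponent i k) = of_real ((2 * real k + 1 - 2 * real i)\<^sup>2 / (8 * (2 * real k + 1)))"
    by (simp add: of_rat_divide of_rat_power of_rat_mult of_rat_add of_rat_diff)
  also have "(2 * real k + 1 - 2 * real i)\<^sup>2 / (8 * (2 * real k + 1)) = p * b\<^sup>2 / 2"
  proof -
    have "2 * real k + 1 - 2 * real i = p * b * 2" using p by (simp add: b_def right_diff_distrib)
    thus ?thesis unfolding p(2)[symmetric] using p(1) by (simp add: power2_eq_square)
  qed
  finally have "complex_of_rat (1 / 24 + ch_exponent i k) = of_real (p * b\<^sup>2 / 2)" .
  hence "qpow (1 / 24 + ch_exponent i k) (\<i> * t) = exp (of_real (- (pi * (p * t) * b\<^sup>2)))"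
    unfolding qpow_def by (simp add: mult_ac)
  hence 3: "qpow (1 / 24 + ch_exponent i k) (\<i> * t) = inverse (of_real c)"
    by (simp add: c_def exp_minus flip: exp_of_real)
  have "c \<noteq> 0" by (simp add: c_def)
  thus ?thesis using eta_mult_ch[OF z, of i k] 1 2 3 p(2) by (simp add: b_def)
qed

section \<open>Inversion of the characters\<close>

lemma open_upper_half_plane [simp]: "open \<H>"
  by (simp add: upper_half_plane_def open_halfspace_Im_gt)

lemma connected_upper_half_plane: "connected \<H>"
  by (simp add: upper_half_plane_def convex_connected convex_halfspace_Im_gt)

lemma upper_half_plane_nonzero: "z \<in> \<H> \<Longrightarrow> z \<noteq> 0"
  by (auto simp: upper_half_plane_def)

lemma minus_inverse_in_upper_half_plane: "z \<in> \<H> \<Longrightarrow> - 1 / z \<in> \<H>"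
  by (auto simp: upper_half_plane_def Im_divide zero_less_divide_iff power2_eq_square intro: add_nonneg_pos)

lemma qpow_holomorphic: "qpow a holomorphic_on A"
  unfolding qpow_def by (intro holomorphic_intros)

lemma nome_holomorphic: "nome holomorphic_on A"
  unfolding nome_def by (intro holomorphic_intros)

lemma holomorphic_compose_nome:
  assumes "P holomorphic_on ball 0 1"
  shows "(\<lambda>z. P (nome z)) holomorphic_on \<H>"
proof -
  have "nome ` \<H> \<subseteq> ball 0 1" using norm_nome_less_1 by auto
  from holomorphic_on_compose_gen[OF nome_holomorphic assms this] show ?thesis by (simp add: o_def)
qed

lemma ch_cofactor_holomorphic: "(\<lambda>q. inverse (euler_prod (ch_index i k) q)) holomorphic_on ball 0 1"
  by (intro holomorphic_on_inverse euler_prod_holomorphic) (use euler_prod_nonzero in auto)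

lemma ch_holomorphic: "ch i k holomorphic_on \<H>"
proof -
  have "(\<lambda>z. qpow (ch_exponent i k) z * inverse (euler_prod (ch_index i k) (nome z))) holomorphic_on \<H>"
    by (intro holomorphic_on_mult qpow_holomorphic holomorphic_compose_nome ch_cofactor_holomorphic)
  thus ?thesis by (rule holomorphic_transform) (simp add: ch_eq)
qed

lemma dedekind_eta_holomorphic: "dedekind_eta holomorphic_on \<H>"
  unfolding dedekind_eta_def
  by (intro holomorphic_on_mult qpow_holomorphic holomorphic_compose_nome euler_prod_holomorphic) auto

lemma dedekind_eta_nonzero: "z \<in> \<H> \<Longrightarrow> dedekind_eta z \<noteq> 0"
  by (simp add: dedekind_eta_def euler_prod_nonzero norm_nome_less_1)

lemma eq_0_if_eq_0_imag_axis:
  assumes "f holomorphic_on \<H>" "\<And>t::real. (0::real) < t \<Longrightarrow> f (\<i> * of_real t) = 0" and z: "z \<in> \<H>"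
  shows "f z = 0"
proof (rule analytic_continuation[OF assms(1) _ connected_upper_half_plane _ _ _ _ z])
  define U where "U = (\<lambda>t::real. \<i> * complex_of_real t) ` {0<..}"
  show "U \<subseteq> \<H>" by (auto simp: U_def upper_half_plane_def)
  show "\<i> \<in> \<H>" by (simp add: upper_half_plane_def)
  show "\<i> islimpt U"
    unfolding islimpt_approachable
  proof (intro allI impI)
    fix e :: real assume e: "e > 0"
    have "\<i> * complex_of_real (1 + e / 2) \<in> U" unfolding U_def by (rule imageI) (use e in simp)
    moreover have "dist (\<i> * complex_of_real (1 + e / 2)) \<i> < e"
      using e by (simp add: dist_norm algebra_simps norm_mult)
    moreover have "\<i> * complex_of_real (1 + e / 2) \<noteq> \<i>" using e by (simp add: complex_eq_iff)
    ultimately show "\<exists>x'\<in>U. x' \<noteq> \<i> \<and> dist x' \<i> < e" by blast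
  qed
  show "f w = 0" if "w \<in> U" for w using that assms(2) by (auto simp: U_def)
qed simp

lemma minus_inverse_imag: "- 1 / (\<i> * complex_of_real t) = \<i> * complex_of_real (1 / t)"
  by (cases "t = 0") (simp_all add: field_simps)

text \<open>The residues 0, 1 and -1 exhaust everything modulo 3, so the product is empty, and the
  exponent is 0 as well.\<close>

lemma ch_1_1:
  assumes "z \<in> \<H>"
  shows "ch 1 1 z = 1"
proof -
  have "\<not> ch_index 1 1 n" for n
  proof -
    have "int n mod 3 = 0 \<or> int n mod 3 = 1 \<or> int n mod 3 = 2" by presburger
    thus ?thesis by (auto simp: ch_index_def cong_def)
  qed
  hence "euler_prod (ch_index 1 1) (nome z) = 1" by (simp add: euler_prod_def)
  moreover have "ch_exponent 1 1 = 0" by (subst ch_exponent_eq) auto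
  ultimately show ?thesis using assms by (simp add: ch_eq qpow_def)
qed

lemma eta_mult_ch_inversion_imag_axis:
  assumes "1 \<le> i" "i \<le> k"
  obtains A where "\<And>t::real. (0::real) < t \<Longrightarrow> dedekind_eta (\<i> * of_real (1 / t)) * ch i k (\<i> * of_real (1 / t)) =
     of_real (sqrt t) * (\<Sum>j<k. A j * (dedekind_eta (\<i> * of_real t) * ch (Suc j) k (\<i> * of_real t)))"
proof -
  define p where "p = 2 * real k + 1"
  have p: "p > 0" by (simp add: p_def)
  define C where "C = (\<lambda>r. cis (- (2 * pi * (1 / 2 - real i / p) * (real r + 1 / 2))))"
  define A where "A = (\<lambda>j. of_real (1 / sqrt p) * (C (k - Suc j) - C (2 * k - (k - Suc j))))"
  show ?thesis
  proof (rule that)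
    fix t :: real assume t: "t > 0"
    have "dedekind_eta (\<i> * of_real (1 / t)) * ch i k (\<i> * of_real (1 / t)) = alt_theta (p / t) (1 / 2 - real i / p)"
      using eta_mult_ch_imag_axis[OF assms, of "1 / t"] t by (simp add: p_def)
    also have "\<dots> = of_real (sqrt (t / p)) *
     (\<Sum>j<k. (C (k - Suc j) - C (2 * k - (k - Suc j))) * alt_theta (p * t) (1 / 2 - real (Suc j) / p))"
      using alt_theta_inversion[OF t, of k i] by (simp add: C_def p_def)
    also have "(\<Sum>j<k. (C (k - Suc j) - C (2 * k - (k - Suc j))) * alt_theta (p * t) (1 / 2 - real (Suc j) / p)) =
       (\<Sum>j<k. (C (k - Suc j) - C (2 * k - (k - Suc j))) * (dedekind_eta (\<i> * of_real t) * ch (Suc j) k (\<i> * of_real t)))"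
      using t by (intro sum.cong refl arg_cong2[of _ _ _ _ "(*)"]) (subst eta_mult_ch_imag_axis, auto simp: p_def)
    also have "of_real (sqrt (t / p)) * \<dots> = of_real (sqrt t) * (\<Sum>j<k. A j * (dedekind_eta (\<i> * of_real t) * ch (Suc j) k (\<i> * of_real t)))"
      by (simp add: A_def real_sqrt_divide sum_distrib_left sum_distrib_right mult_ac)
    finally show "dedekind_eta (\<i> * of_real (1 / t)) * ch i k (\<i> * of_real (1 / t)) =
     of_real (sqrt t) * (\<Sum>j<k. A j * (dedekind_eta (\<i> * of_real t) * ch (Suc j) k (\<i> * of_real t)))" .
  qed
qed

lemma imag_axis_in_upper_half_plane: "t > 0 \<Longrightarrow> \<i> * complex_of_real t \<in> \<H>"
  by (simp add: upper_half_plane_def)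

lemma eta_inversion_imag_axis:
  obtains s where "s \<noteq> 0"
    "\<And>t::real. (0::real) < t \<Longrightarrow> dedekind_eta (\<i> * of_real (1 / t)) = of_real (sqrt t) * s * dedekind_eta (\<i> * of_real t)"
proof -
  obtain A where A: "\<And>t::real. (0::real) < t \<Longrightarrow> dedekind_eta (\<i> * of_real (1 / t)) * ch 1 1 (\<i> * of_real (1 / t)) =
     of_real (sqrt t) * (\<Sum>j<1. A j * (dedekind_eta (\<i> * of_real t) * ch (Suc j) 1 (\<i> * of_real t)))"
    using eta_mult_ch_inversion_imag_axis[of 1 1] by blast
  have *: "dedekind_eta (\<i> * of_real (1 / t)) = of_real (sqrt t) * A 0 * dedekind_eta (\<i> * of_real t)" if "t > 0" for t :: real
  proof -
    have "ch 1 1 (\<i> * of_real (1 / t)) = 1" "ch (Suc 0) 1 (\<i> * of_real t) = 1"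
      using ch_1_1[OF imag_axis_in_upper_half_plane[of t]] ch_1_1[OF imag_axis_in_upper_half_plane[of "1 / t"]] that
      by simp_all
    thus ?thesis using A[OF that] by simp
  qed
  \<comment> \<open>At \<open>t = 1\<close>, the fixed point of the inversion, the left side is the
    nonzero value of eta at \<open>\<i>\<close>.\<close>
  moreover have "A 0 \<noteq> 0"
    using *[of 1] dedekind_eta_nonzero[of \<i>] by (auto simp: upper_half_plane_def)
  ultimately show ?thesis using that by blast
qed

lemma holomorphic_compose_minus_inverse:
  assumes "f holomorphic_on \<H>"
  shows "(\<lambda>z. f (- 1 / z)) holomorphic_on \<H>"
proof -
  have "(\<lambda>z. - 1 / z) holomorphic_on \<H>"
    by (intro holomorphic_intros) (auto simp: upper_half_plane_nonzero)
  from holomorphic_on_compose_gen[OF this assms] show ?thesis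
    using minus_inverse_in_upper_half_plane by (auto simp: o_def)
qed

text \<open>Squaring avoids a branch of the square root of \<open>z\<close>, so both sides are
  holomorphic and the identity theorem applies.\<close>

theorem eta_inversion:
  obtains c where "c \<noteq> 0" "\<And>z. z \<in> \<H> \<Longrightarrow> dedekind_eta (- 1 / z) ^ 2 = c * z * dedekind_eta z ^ 2"
proof -
  obtain s where s: "s \<noteq> 0"
    "\<And>t::real. (0::real) < t \<Longrightarrow> dedekind_eta (\<i> * of_real (1 / t)) = of_real (sqrt t) * s * dedekind_eta (\<i> * of_real t)"
    using eta_inversion_imag_axis by blast
  \<comment> \<open>On the axis \<open>z = \<i> * t\<close>, hence
    \<open>t = - \<i> * z\<close>.\<close>
  define c where "c = - \<i> * s ^ 2"
  have "dedekind_eta (- 1 / z) ^ 2 - c * z * dedekind_eta z ^ 2 = 0" if z: "z \<in> \<H>" for z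
  proof (rule eq_0_if_eq_0_imag_axis[OF _ _ z])
    show "(\<lambda>z. dedekind_eta (- 1 / z) ^ 2 - c * z * dedekind_eta z ^ 2) holomorphic_on \<H>"
      by (intro holomorphic_intros holomorphic_compose_minus_inverse dedekind_eta_holomorphic)
    show "dedekind_eta (- 1 / (\<i> * of_real t)) ^ 2 - c * (\<i> * of_real t) * dedekind_eta (\<i> * of_real t) ^ 2 = 0" if "t > 0" for t :: real
    proof -
      have "complex_of_real (sqrt t) ^ 2 = of_real t" using that by (simp flip: of_real_power)
      thus ?thesis unfolding minus_inverse_imag s(2)[OF that]
          by (simp add: c_def power_mult_distrib algebra_simps)
    qed
  qed
  moreover have "c \<noteq> 0" using s by (simp add: c_def)
  ultimately show ?thesis using that[of c] by simp
qed

text \<open>The inversion formula for eta times a character and the one for eta itself carry the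
  same factor \<open>sqrt t\<close>. Dividing leaves a relation of weight 0 with constant
  coefficients, which continues analytically from the axis.\<close>

theorem ch_inversion:
  obtains S where "\<And>i z. i < k \<Longrightarrow> z \<in> \<H> \<Longrightarrow> ch (Suc i) k (- 1 / z) = (\<Sum>j<k. S i j * ch (Suc j) k z)"
proof -
  obtain s where s: "s \<noteq> 0"
    "\<And>t::real. (0::real) < t \<Longrightarrow> dedekind_eta (\<i> * of_real (1 / t)) = of_real (sqrt t) * s * dedekind_eta (\<i> * of_real t)"
    using eta_inversion_imag_axis by blast
  have "\<forall>i\<in>{..<k}. \<exists>B. \<forall>z\<in>\<H>. ch (Suc i) k (- 1 / z) = (\<Sum>j<k. B j * ch (Suc j) k z)"
  proof
    fix i assume "i \<in> {..<k}"
    hence i: "1 \<le> Suc i" "Suc i \<le> k" by auto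
    obtain A where A: "\<And>t::real. (0::real) < t \<Longrightarrow> dedekind_eta (\<i> * of_real (1 / t)) * ch (Suc i) k (\<i> * of_real (1 / t)) =
       of_real (sqrt t) * (\<Sum>j<k. A j * (dedekind_eta (\<i> * of_real t) * ch (Suc j) k (\<i> * of_real t)))"
      using eta_mult_ch_inversion_imag_axis[OF i] by blast
    define B where "B = (\<lambda>j. A j / s)"
    have "ch (Suc i) k (- 1 / z) - (\<Sum>j<k. B j * ch (Suc j) k z) = 0" if z: "z \<in> \<H>" for z
    proof (rule eq_0_if_eq_0_imag_axis[of "\<lambda>z. ch (Suc i) k (- 1 / z) - (\<Sum>j<k. B j * ch (Suc j) k z)", OF _ _ z])
      show "(\<lambda>z. ch (Suc i) k (- 1 / z) - (\<Sum>j<k. B j * ch (Suc j) k z)) holomorphic_on \<H>"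
        by (intro holomorphic_intros holomorphic_compose_minus_inverse ch_holomorphic)
      show "ch (Suc i) k (- 1 / (\<i> * of_real t)) - (\<Sum>j<k. B j * ch (Suc j) k (\<i> * of_real t)) = 0" if t: "t > 0" for t :: real
      proof -
        have "of_real (sqrt t) * dedekind_eta (\<i> * of_real t) * (s * ch (Suc i) k (\<i> * of_real (1 / t))) =
              of_real (sqrt t) * dedekind_eta (\<i> * of_real t) * (\<Sum>j<k. A j * ch (Suc j) k (\<i> * of_real t))"
          using A[OF t] unfolding s(2)[OF t] by (simp add: sum_distrib_left mult_ac)
        hence "s * ch (Suc i) k (\<i> * of_real (1 / t)) = (\<Sum>j<k. A j * ch (Suc j) k (\<i> * of_real t))"
          using t dedekind_eta_nonzero[OF imag_axis_in_upper_half_plane[OF t]] by simp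
        hence "ch (Suc i) k (\<i> * of_real (1 / t)) = (\<Sum>j<k. A j * ch (Suc j) k (\<i> * of_real t)) / s"
          using s(1) by (simp add: field_simps)
        thus ?thesis unfolding minus_inverse_imag B_def by (simp add: sum_divide_distrib)
      qed
    qed
    thus "\<exists>B. \<forall>z\<in>\<H>. ch (Suc i) k (- 1 / z) = (\<Sum>j<k. B j * ch (Suc j) k z)" by auto
  qed
  from bchoice[OF this] obtain S where
    "\<forall>i\<in>{..<k}. \<forall>z\<in>\<H>. ch (Suc i) k (- 1 / z) = (\<Sum>j<k. S i j * ch (Suc j) k z)" by blast
  thus ?thesis using that by blast
qed

section \<open>Inversion of the Wronskians\<close>

lemma qderiv_holomorphic: "f holomorphic_on \<H> \<Longrightarrow> qderiv f holomorphic_on \<H>"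
  unfolding qderiv_def by (intro holomorphic_intros) auto

lemma qderiv_funpow_holomorphic: "f holomorphic_on \<H> \<Longrightarrow> (qderiv ^^ m) f holomorphic_on \<H>"
  by (induction m) (auto intro: qderiv_holomorphic)

lemma has_field_derivative_qderiv:
  assumes "f holomorphic_on \<H>" "z \<in> \<H>"
  shows "(f has_field_derivative 2 * of_real pi * \<i> * qderiv f z) (at z)"
  using holomorphic_derivI[OF assms(1) _ assms(2)] by (simp add: qderiv_def)

lemma qderiv_eqI: "(f has_field_derivative 2 * of_real pi * \<i> * D) (at z) \<Longrightarrow> qderiv f z = D"
  by (simp add: qderiv_def DERIV_imp_deriv)

lemma qderiv_cong:
  assumes "\<And>w. w \<in> \<H> \<Longrightarrow> f w = g w" "z \<in> \<H>"
  shows "qderiv f z = qderiv g z"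
proof -
  have "eventually (\<lambda>w. f w = g w) (nhds z)"
    using eventually_nhds_in_open[OF open_upper_half_plane assms(2)] assms(1) by (auto elim: eventually_mono)
  thus ?thesis by (simp add: qderiv_def deriv_cong_ev)
qed

lemma qderiv_funpow_sum:
  assumes "\<And>i. i \<in> I \<Longrightarrow> f i holomorphic_on \<H>" "\<And>w. w \<in> \<H> \<Longrightarrow> g w = (\<Sum>i\<in>I. c i * f i w)" "z \<in> \<H>"
  shows "(qderiv ^^ m) g z = (\<Sum>i\<in>I. c i * (qderiv ^^ m) (f i) z)"
  using assms(3)
proof (induction m arbitrary: z)
  case (Suc m)
  have "(qderiv ^^ Suc m) g z = qderiv (\<lambda>z. \<Sum>i\<in>I. c i * (qderiv ^^ m) (f i) z) z"
    using Suc by (simp, intro qderiv_cong) auto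
  also have "\<dots> = (\<Sum>i\<in>I. c i * (qderiv ^^ Suc m) (f i) z)"
  proof (rule qderiv_eqI)
    show "((\<lambda>z. \<Sum>i\<in>I. c i * (qderiv ^^ m) (f i) z) has_field_derivative 2 * of_real pi * \<i> * (\<Sum>i\<in>I. c i * (qderiv ^^ Suc m) (f i) z)) (at z)"
      using assms(1) Suc.prems
      by (auto intro!: derivative_eq_intros has_field_derivative_qderiv qderiv_funpow_holomorphic simp: sum_distrib_left mult_ac)
  qed
  finally show ?case .
qed (use assms(2) in auto)

text \<open>Coefficients of the chain rule for iterated derivatives of \<open>f (- 1 / z)\<close>.\<close>

fun inversion_coeff :: "nat \<Rightarrow> nat \<Rightarrow> complex \<Rightarrow> complex" where
  "inversion_coeff 0 l = (if l = 0 then (\<lambda>_. 1) else (\<lambda>_. 0))"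
| "inversion_coeff (Suc m) l = (\<lambda>z. qderiv (inversion_coeff m l) z + (if l = 0 then 0 else inversion_coeff m (l - 1) z / z ^ 2))"

lemma qderiv_const [simp]: "qderiv (\<lambda>_. c) = (\<lambda>_. 0)"
  by (simp add: qderiv_def fun_eq_iff)

lemma inversion_coeff_holomorphic: "inversion_coeff m l holomorphic_on \<H>"
proof (induction m arbitrary: l)
  case 0
  show ?case by (cases "l = 0") auto
next
  case (Suc m)
  show ?case
  proof (cases "l = 0")
    case True
    thus ?thesis using qderiv_holomorphic[OF Suc[of 0]] by simp
  next
    case False
    have "(\<lambda>z. qderiv (inversion_coeff m l) z + inversion_coeff m (l - 1) z / z ^ 2) holomorphic_on \<H>"
      by (intro holomorphic_intros qderiv_holomorphic Suc) (auto simp: upper_half_plane_nonzero)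
    thus ?thesis using False by simp
  qed
qed

lemma inversion_coeff_above: "m < l \<Longrightarrow> inversion_coeff m l = (\<lambda>_. 0)"
  by (induction m arbitrary: l) auto

text \<open>Undifferentiated \<open>f\<close> disappears after the first derivative. This is what
  lets a Wronskian whose rows start at order 1 transform into itself.\<close>

lemma inversion_coeff_Suc_0: "inversion_coeff (Suc m) 0 = (\<lambda>_. 0)"
  by (induction m) simp_all

lemma inversion_coeff_diag: "inversion_coeff m m z = 1 / z ^ (2 * m)"
proof (induction m)
  case (Suc m)
  thus ?case by (simp add: inversion_coeff_above power2_eq_square)
qed auto

lemma qderiv_funpow_minus_inverse:
  assumes f: "f holomorphic_on \<H>" and "z \<in> \<H>"
  shows "(qderiv ^^ m) (\<lambda>z. f (- 1 / z)) z = (\<Sum>l\<le>m. inversion_coeff m l z * (qderiv ^^ l) f (- 1 / z))"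
  using assms(2)
proof (induction m arbitrary: z)
  case (Suc m)
  define B where "B = inversion_coeff m"
  define F where "F = (\<lambda>l. (qderiv ^^ l) f)"
  have z: "z \<noteq> 0" using Suc.prems by (rule upper_half_plane_nonzero)
  have "(qderiv ^^ Suc m) (\<lambda>z. f (- 1 / z)) z = qderiv (\<lambda>z. \<Sum>l\<le>m. B l z * F l (- 1 / z)) z"
    using Suc unfolding B_def F_def by (simp, intro qderiv_cong) auto
  also have "\<dots> = (\<Sum>l\<le>m. qderiv (B l) z * F l (- 1 / z) + B l z / z ^ 2 * F (Suc l) (- 1 / z))"
  proof (rule qderiv_eqI)
    have d1: "((\<lambda>z. F l (- 1 / z)) has_field_derivative 2 * of_real pi * \<i> * (F (Suc l) (- 1 / z) / z ^ 2)) (at z)" for l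
    proof -
      have "(F l has_field_derivative 2 * of_real pi * \<i> * F (Suc l) (- 1 / z)) (at (- 1 / z))"
        unfolding F_def using has_field_derivative_qderiv[OF qderiv_funpow_holomorphic[OF f] minus_inverse_in_upper_half_plane[OF Suc.prems], of l] by simp
      moreover have "((\<lambda>z. - 1 / z) has_field_derivative 1 / z ^ 2) (at z)"
        using z by (auto intro!: derivative_eq_intros simp: power2_eq_square)
      ultimately show ?thesis using DERIV_chain2 by fastforce
    qed
    have d2: "(B l has_field_derivative 2 * of_real pi * \<i> * qderiv (B l) z) (at z)" for l
      unfolding B_def by (intro has_field_derivative_qderiv inversion_coeff_holomorphic Suc.prems)
    have "((\<lambda>z. B l z * F l (- 1 / z)) has_field_derivative
       2 * of_real pi * \<i> * (qderiv (B l) z * F l (- 1 / z) + B l z / z ^ 2 * F (Suc l) (- 1 / z))) (at z)" for l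
      by (rule DERIV_cong[OF DERIV_mult[OF d2 d1]]) (simp add: algebra_simps)
    thus "((\<lambda>z. \<Sum>l\<le>m. B l z * F l (- 1 / z)) has_field_derivative
       2 * of_real pi * \<i> * (\<Sum>l\<le>m. qderiv (B l) z * F l (- 1 / z) + B l z / z ^ 2 * F (Suc l) (- 1 / z))) (at z)"
      unfolding sum_distrib_left by (intro DERIV_sum)
  qed
  also have "\<dots> = (\<Sum>l\<le>Suc m. qderiv (B l) z * F l (- 1 / z)) + (\<Sum>l\<le>m. B l z / z ^ 2 * F (Suc l) (- 1 / z))"
    by (simp add: sum.distrib B_def inversion_coeff_above)
  also have "(\<Sum>l\<le>m. B l z / z ^ 2 * F (Suc l) (- 1 / z)) = (\<Sum>l\<le>Suc m. (if l = 0 then 0 else B (l - 1) z / z ^ 2) * F l (- 1 / z))"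
    by (subst sum.atMost_Suc_shift) simp
  also have "(\<Sum>l\<le>Suc m. qderiv (B l) z * F l (- 1 / z)) + \<dots> = (\<Sum>l\<le>Suc m. inversion_coeff (Suc m) l z * F l (- 1 / z))"
    unfolding B_def inversion_coeff.simps by (simp only: sum.distrib distrib_right)
  finally show ?case by (simp add: F_def)
qed auto

section \<open>Determinant identities and the transformation of the Wronskians\<close>

lemma det_mat_cong:
  assumes "\<And>m j. m < k \<Longrightarrow> j < k \<Longrightarrow> a m j = b m j"
  shows "Determinant.det (Matrix.mat k k (\<lambda>(m, j). a m j)) = Determinant.det (Matrix.mat k k (\<lambda>(m, j). b m j))"
  by (intro arg_cong[of _ _ Determinant.det] eq_matI) (auto simp: assms)

lemma det_mat_mult:
  fixes a b :: "nat \<Rightarrow> nat \<Rightarrow> 'a :: comm_ring_1"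
  shows "Determinant.det (Matrix.mat k k (\<lambda>(m, j). \<Sum>l<k. a m l * b l j)) =
    Determinant.det (Matrix.mat k k (\<lambda>(m, j). a m j)) * Determinant.det (Matrix.mat k k (\<lambda>(m, j). b m j))"
proof -
  have "Matrix.mat k k (\<lambda>(m, j). \<Sum>l<k. a m l * b l j) = Matrix.mat k k (\<lambda>(m, j). a m j) * Matrix.mat k k (\<lambda>(m, j). b m j)"
    by (intro eq_matI) (auto simp: scalar_prod_def lessThan_atLeast0)
  thus ?thesis by (simp add: det_mult[of _ k])
qed

lemma det_mat_lower_triangular:
  fixes a :: "nat \<Rightarrow> nat \<Rightarrow> 'a :: comm_ring_1"
  assumes "\<And>m j. m < j \<Longrightarrow> j < k \<Longrightarrow> a m j = 0"
  shows "Determinant.det (Matrix.mat k k (\<lambda>(m, j). a m j)) = (\<Prod>m<k. a m m)"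
proof -
  have "Determinant.det (Matrix.mat k k (\<lambda>(m, j). a m j)) = prod_list (diag_mat (Matrix.mat k k (\<lambda>(m, j). a m j)))"
    by (rule det_lower_triangular[of k]) (auto simp: assms)
  also have "\<dots> = (\<Prod>m<k. a m m)"
    by (simp add: prod_list_diag_prod lessThan_atLeast0)
  finally show ?thesis .
qed

text \<open>The determinant of the derivatives of \<open>ch (Suc j) k (- 1 / z)\<close> is computed
  twice: the linear relations act on the columns and give the factor \<open>D\<close>, the chain
  rule acts on the rows by a triangular matrix with diagonal \<open>1 / z ^ (2 * (s + m))\<close>.
  \<open>D\<close> depends on the relations alone, so one constant serves both Wronskians.\<close>

theorem wronskian_inversion:
  obtains D where "\<And>s z. s \<le> 1 \<Longrightarrow> z \<in> \<H> \<Longrightarrow> wronskian_det s k (- 1 / z) = z ^ (k * (k - 1) + 2 * s * k) * (D * wronskian_det s k z)"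
proof -
  obtain S where S: "\<And>i z. i < k \<Longrightarrow> z \<in> \<H> \<Longrightarrow> ch (Suc i) k (- 1 / z) = (\<Sum>j<k. S i j * ch (Suc j) k z)"
    using ch_inversion by blast
  define D where "D = Determinant.det (Matrix.mat k k (\<lambda>(l, j). S j l))"
  show ?thesis
  proof (rule that)
    fix s z assume s: "s \<le> (1::nat)" and z: "z \<in> \<H>"
    define N where "N = (\<lambda>m j. (qderiv ^^ (s + m)) (\<lambda>z. ch (Suc j) k (- 1 / z)) z)"
    have "Determinant.det (Matrix.mat k k (\<lambda>(m, j). N m j)) = 
          Determinant.det (Matrix.mat k k (\<lambda>(m, j). \<Sum>l<k. (qderiv ^^ (s + m)) (ch (Suc l) k) z * S j l))"
    proof (rule det_mat_cong)
      fix m j assume "j < k"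
      show "N m j = (\<Sum>l<k. (qderiv ^^ (s + m)) (ch (Suc l) k) z * S j l)"
        unfolding N_def using S[OF \<open>j < k\<close>] z
        by (subst qderiv_funpow_sum[of "{..<k}" "\<lambda>l. ch (Suc l) k" _ "S j"]) (auto simp: ch_holomorphic mult_ac)
    qed
    also have "\<dots> = wronskian_det s k z * D"
      unfolding det_mat_mult by (simp add: D_def wronskian_det_def)
    finally have 1: "Determinant.det (Matrix.mat k k (\<lambda>(m, j). N m j)) = wronskian_det s k z * D" .
    have "Determinant.det (Matrix.mat k k (\<lambda>(m, j). N m j)) = 
          Determinant.det (Matrix.mat k k (\<lambda>(m, j). \<Sum>l<k. inversion_coeff (s + m) (s + l) z * (qderiv ^^ (s + l)) (ch (Suc j) k) (- 1 / z)))"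
    proof (rule det_mat_cong)
      fix m j assume "m < k"
      define T where "T = (\<lambda>l. inversion_coeff (s + m) l z * (qderiv ^^ l) (ch (Suc j) k) (- 1 / z))"
      have "N m j = (\<Sum>l\<le>s + m. T l)"
        unfolding N_def T_def by (rule qderiv_funpow_minus_inverse[OF ch_holomorphic z])
      \<comment> \<open>Terms above \<open>s + m\<close> vanish by triangularity. Below
        \<open>s\<close> the only term lost is \<open>l = 0\<close> when \<open>s = 1\<close>, and
        its coefficient is 0; a larger \<open>s\<close> would in general lose nonzero terms.\<close>
      also have "\<dots> = (\<Sum>l\<in>{s..<s + k}. T l)"
      proof (rule sum.mono_neutral_cong)
        fix l assume l: "l \<in> {..s + m} - {s..<s + k}"
        hence "s = 1" "l = 0" using s \<open>m < k\<close> by auto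
        thus "T l = 0" unfolding T_def using inversion_coeff_Suc_0[of m] by simp
      qed (auto simp: T_def inversion_coeff_above)
      also have "\<dots> = (\<Sum>l<k. T (s + l))"
        using sum.shift_bounds_nat_ivl[of T 0 s k] by (simp add: lessThan_atLeast0 add.commute)
      finally show "N m j = (\<Sum>l<k. inversion_coeff (s + m) (s + l) z * (qderiv ^^ (s + l)) (ch (Suc j) k) (- 1 / z))"
        by (simp add: T_def)
    qed
    also have "\<dots> = Determinant.det (Matrix.mat k k (\<lambda>(m, l). inversion_coeff (s + m) (s + l) z)) * wronskian_det s k (- 1 / z)"
      unfolding det_mat_mult by (simp add: wronskian_det_def)
    also have "Determinant.det (Matrix.mat k k (\<lambda>(m, l). inversion_coeff (s + m) (s + l) z)) = (\<Prod>m<k. 1 / z ^ (2 * (s + m)))"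
      by (subst det_mat_lower_triangular) (auto simp: inversion_coeff_above inversion_coeff_diag)
    also have "\<dots> = 1 / z ^ (k * (k - 1) + 2 * s * k)"
    proof (induction k)
      case (Suc k)
      have "Suc k * (Suc k - 1) + 2 * s * Suc k = k * (k - 1) + 2 * s * k + 2 * (s + k)"
        by (cases k) (auto simp: algebra_simps)
      thus ?case using Suc by (simp add: power_add)
    qed auto
    finally show "wronskian_det s k (- 1 / z) = z ^ (k * (k - 1) + 2 * s * k) * (D * wronskian_det s k z)"
      using 1 upper_half_plane_nonzero[OF z] by (simp add: field_simps)
  qed
qed

section \<open>The Wronskians as functions of the nome\<close>

text \<open>The operator q d/dq conjugated by the fractional power \<open>qpow a\<close>. It acts on
  functions that are single-valued in \<open>q\<close>, and at \<open>q = 0\<close> it is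
  multiplication by \<open>a\<close>, which is how powers of the exponents enter.\<close>

definition cusp_deriv :: "rat \<Rightarrow> (complex \<Rightarrow> complex) \<Rightarrow> complex \<Rightarrow> complex" where
  "cusp_deriv a P q = of_rat a * P q + q * deriv P q"

lemma cusp_deriv_funpow_holomorphic:
  "P holomorphic_on ball 0 1 \<Longrightarrow> (cusp_deriv a ^^ m) P holomorphic_on ball 0 1"
proof (induction m)
  case (Suc m)
  have "cusp_deriv a ((cusp_deriv a ^^ m) P) holomorphic_on ball 0 1"
    unfolding cusp_deriv_def by (intro holomorphic_intros Suc.IH[OF Suc.prems, unfolded cusp_deriv_def]) auto
  thus ?case by simp
qed auto

lemma cusp_deriv_funpow_0: "(cusp_deriv a ^^ m) P 0 = of_rat a ^ m * P 0"
  by (induction m) (simp_all add: cusp_deriv_def)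

lemma qderiv_funpow_qpow_mult:
  assumes P: "P holomorphic_on ball 0 1" and f: "\<And>z. z \<in> \<H> \<Longrightarrow> f z = qpow a z * P (nome z)" and "z \<in> \<H>"
  shows "(qderiv ^^ m) f z = qpow a z * (cusp_deriv a ^^ m) P (nome z)"
  using assms(3)
proof (induction m arbitrary: z)
  case (Suc m)
  define R where "R = (cusp_deriv a ^^ m) P"
  have "nome z \<in> ball 0 1" using norm_nome_less_1[OF Suc.prems] by simp
  hence "(R has_field_derivative deriv R (nome z)) (at (nome z))"
    unfolding R_def by (intro holomorphic_derivI[OF cusp_deriv_funpow_holomorphic[OF P]]) auto
  moreover have "(nome has_field_derivative 2 * of_real pi * \<i> * nome z) (at z)"
    unfolding nome_def by (auto intro!: derivative_eq_intros)
  ultimately have d1: "((\<lambda>z. R (nome z)) has_field_derivative deriv R (nome z) * (2 * of_real pi * \<i> * nome z)) (at z)"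
    by (rule DERIV_chain2)
  have d2: "(qpow a has_field_derivative 2 * of_real pi * \<i> * of_rat a * qpow a z) (at z)"
    unfolding qpow_def by (auto intro!: derivative_eq_intros)
  have "(qderiv ^^ Suc m) f z = qderiv (\<lambda>z. qpow a z * R (nome z)) z"
    using Suc unfolding R_def by (simp, intro qderiv_cong) auto
  also have "\<dots> = qpow a z * cusp_deriv a R (nome z)"
    by (rule qderiv_eqI, rule DERIV_cong[OF DERIV_mult[OF d2 d1]]) (simp add: cusp_deriv_def algebra_simps)
  finally show ?case by (simp add: R_def)
qed (use f in auto)

definition cusp_wronskian :: "nat \<Rightarrow> nat \<Rightarrow> complex \<Rightarrow> complex" where
  "cusp_wronskian s k q = Determinant.det (Matrix.mat k k (\<lambda>(m, j).
     (cusp_deriv (ch_exponent (Suc j) k) ^^ (s + m)) (\<lambda>q. inverse (euler_prod (ch_index (Suc j) k) q)) q))"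

lemma cusp_wronskian_holomorphic: "cusp_wronskian s k holomorphic_on ball 0 1"
proof -
  define A where "A = (\<lambda>m j. (cusp_deriv (ch_exponent (Suc j) k) ^^ (s + m)) (\<lambda>q. inverse (euler_prod (ch_index (Suc j) k) q)))"
  have "(\<lambda>q. \<Sum>p | p permutes {0..<k}. signof p * (\<Prod>i = 0..<k. A i (p i) q)) holomorphic_on ball 0 1"
    by (intro holomorphic_intros holomorphic_on_sum holomorphic_on_prod)
       (auto simp: A_def intro!: cusp_deriv_funpow_holomorphic ch_cofactor_holomorphic)
  moreover have "cusp_wronskian s k q = (\<Sum>p | p permutes {0..<k}. signof p * (\<Prod>i = 0..<k. A i (p i) q))" for q
    unfolding cusp_wronskian_def
    by (subst det_def'[of _ k]) (auto simp: A_def permutes_def intro!: sum.cong prod.cong)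
  ultimately show ?thesis by (simp cong: holomorphic_cong)
qed

text \<open>The exponents are odd squares over \<open>8 * (2 * k + 1)\<close>, less 1/24, so the
  formula for a sum of odd squares applies. The result is the weight \<open>k * (k - 1)\<close> over
  12, precisely the order at the cusp of the power of eta with that weight.\<close>

lemma sum_ch_exponent: "(\<Sum>j<k. ch_exponent (Suc j) k) = of_nat (k * (k - 1)) / 12"
proof -
  have odd: "(\<Sum>j<n. (2 * of_nat j + 1)\<^sup>2) = (of_nat n * (4 * (of_nat n)\<^sup>2 - 1) / 3 :: rat)" for n
    by (induction n) (simp_all add: power2_eq_square field_simps)
  define p where "p = (2 * of_nat k + 1 :: rat)"
  have "p = of_nat (2 * k + 1)" by (simp add: p_def)
  hence p: "p \<noteq> 0" by (simp only: of_nat_eq_0_iff)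
  have "(\<Sum>j<k. ch_exponent (Suc j) k) = (\<Sum>j<k. (2 * of_nat j + 1)\<^sup>2 / (8 * p) - 1 / 24)"
  proof (rule sum.reindex_bij_witness[of _ "\<lambda>j. k - Suc j" "\<lambda>j. k - Suc j"])
    fix j assume j: "j \<in> {..<k}"
    thus "(2 * of_nat (k - Suc j) + 1)\<^sup>2 / (8 * p) - 1 / 24 = ch_exponent (Suc j) k"
      by (subst ch_exponent_eq) (auto simp: p_def of_nat_diff algebra_simps)
  qed auto
  also have "\<dots> = (\<Sum>j<k. (2 * of_nat j + 1)\<^sup>2) / (8 * p) - of_nat k / 24"
    by (simp add: sum_subtractf sum_divide_distrib)
  also have "(\<Sum>j<k. (2 * of_nat j + 1)\<^sup>2) = p * (of_nat k * (2 * of_nat k - 1) / 3)"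
    unfolding odd p_def by (simp add: power2_eq_square algebra_simps)
  also have "p * (of_nat k * (2 * of_nat k - 1) / 3) / (8 * p) - of_nat k / 24 = of_nat k * (of_nat k - 1) / (12 :: rat)"
    using p by (simp add: field_simps)
  also have "of_nat k * (of_nat k - 1) = (of_nat (k * (k - 1)) :: rat)"
    by (cases k) (auto simp: algebra_simps)
  finally show ?thesis .
qed

lemma qpow_sum: "finite A \<Longrightarrow> qpow (\<Sum>j\<in>A. f j) z = (\<Prod>j\<in>A. qpow (f j) z)"
  by (induction A rule: finite_induct) (auto simp: qpow_add, simp add: qpow_def)

lemma wronskian_det_eq:
  assumes z: "z \<in> \<H>"
  shows "wronskian_det s k z = qpow (of_nat (k * (k - 1)) / 12) z * cusp_wronskian s k (nome z)"
proof -
  define a where "a = (\<lambda>j. ch_exponent (Suc j) k)"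
  define A where "A = (\<lambda>m j. (cusp_deriv (a j) ^^ (s + m)) (\<lambda>q. inverse (euler_prod (ch_index (Suc j) k) q)) (nome z))"
  \<comment> \<open>Taking \<open>qpow (a j) z\<close> out of column \<open>j\<close> is
    multiplication by a diagonal matrix on the right.\<close>
  have "wronskian_det s k z = Determinant.det (Matrix.mat k k (\<lambda>(m, j). \<Sum>l<k. A m l * (if l = j then qpow (a j) z else 0)))"
    unfolding wronskian_det_def
  proof (rule det_mat_cong)
    fix m j assume "j < k"
    have "(qderiv ^^ (s + m)) (ch (j + 1) k) z = qpow (a j) z * A m j"
      unfolding A_def a_def by (rule qderiv_funpow_qpow_mult) (use z ch_cofactor_holomorphic ch_eq in auto)
    thus "(qderiv ^^ (s + m)) (ch (j + 1) k) z = (\<Sum>l<k. A m l * (if l = j then qpow (a j) z else 0))"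
      using \<open>j < k\<close> by (simp add: if_distrib[of "\<lambda>x. _ * x"] cong: if_cong)
  qed
  also have "\<dots> = cusp_wronskian s k (nome z) * Determinant.det (Matrix.mat k k (\<lambda>(l, j). if l = j then qpow (a j) z else 0))"
    unfolding det_mat_mult by (simp add: cusp_wronskian_def A_def a_def)
  also have "Determinant.det (Matrix.mat k k (\<lambda>(l, j). if l = j then qpow (a j) z else 0)) = (\<Prod>j<k. qpow (a j) z)"
    by (subst det_mat_lower_triangular) auto
  also have "\<dots> = qpow (of_nat (k * (k - 1)) / 12) z"
    unfolding sum_ch_exponent[symmetric] a_def by (simp add: qpow_sum)
  finally show ?thesis by simp
qed

text \<open>A vector in the kernel of the transpose lists the coefficients of a nonzero polynomial
  of degree below \<open>k\<close> that vanishes at \<open>k\<close> distinct points.\<close>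

lemma vandermonde_nonzero:
  fixes x :: "nat \<Rightarrow> 'a :: field"
  assumes inj: "inj_on x {..<k}"
  shows "Determinant.det (Matrix.mat k k (\<lambda>(m, j). x j ^ m)) \<noteq> 0"
proof
  define A where "A = Matrix.mat k k (\<lambda>(m, j). x j ^ m)"
  assume "Determinant.det (Matrix.mat k k (\<lambda>(m, j). x j ^ m)) = 0"
  hence "Determinant.det (transpose_mat A) = 0" by (subst det_transpose[of _ k]) (auto simp: A_def)
  then obtain v where v: "v \<in> carrier_vec k" "v \<noteq> 0\<^sub>v k" "transpose_mat A *\<^sub>v v = 0\<^sub>v k"
    using det_0_iff_vec_prod_zero_field[of "transpose_mat A" k] by (auto simp: A_def)
  define p where "p = (\<Sum>m<k. Polynomial.monom (vec_index v m) m)"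
  have coeff: "coeff p m = (if m < k then vec_index v m else 0)" for m
    by (simp add: p_def coeff_sum)
  have "\<exists>m<k. vec_index v m \<noteq> 0"
  proof (rule ccontr)
    assume "\<not> (\<exists>m<k. vec_index v m \<noteq> 0)"
    hence "v = 0\<^sub>v k" using v(1) by (intro eq_vecI) auto
    with v(2) show False by simp
  qed
  hence p: "p \<noteq> 0" using coeff by (metis coeff_0)
  have "k > 0" using \<open>\<exists>m<k. vec_index v m \<noteq> 0\<close> by auto
  have "degree p \<le> k - 1" by (rule degree_le) (use \<open>k > 0\<close> in \<open>auto simp: coeff\<close>)
  have root: "poly p (x j) = 0" if j: "j < k" for j
  proof -
    have "poly p (x j) = (\<Sum>m<k. x j ^ m * vec_index v m)"
      by (simp add: p_def poly_sum poly_monom mult.commute)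
    also have "\<dots> = vec_index (transpose_mat A *\<^sub>v v) j"
      using j v(1) by (simp add: A_def scalar_prod_def lessThan_atLeast0)
    finally show ?thesis using v(3) j by simp
  qed
  have "k = card (x ` {..<k})" using inj by (simp add: card_image)
  also have "\<dots> \<le> card {y. poly p y = 0}"
    by (rule card_mono) (use root p in \<open>auto intro: poly_roots_finite\<close>)
  also have "\<dots> \<le> degree p" by (rule card_poly_roots_bound[OF p])
  finally show False using \<open>degree p \<le> k - 1\<close> \<open>k > 0\<close> by simp
qed

text \<open>At \<open>q = 0\<close> every product is 1, so the entries are plain powers of the
  exponents. These are distinct because they come from squares of distinct positive odd
  numbers.\<close>

lemma cusp_wronskian_0_nonzero: "cusp_wronskian 0 k 0 \<noteq> 0"
proof -
  define x where "x = (\<lambda>j. of_rat (ch_exponent (Suc j) k) :: complex)"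
  have "inj_on x {..<k}"
  proof (rule inj_onI)
    fix i j assume ij: "i \<in> {..<k}" "j \<in> {..<k}" "x i = x j"
    define p where "p = (2 * of_nat k + 1 :: rat)"
    have "p = of_nat (2 * k + 1)" by (simp add: p_def)
    hence p: "p \<noteq> 0" by (simp only: of_nat_eq_0_iff)
    have "ch_exponent (Suc i) k = ch_exponent (Suc j) k" using ij(3) by (simp add: x_def)
    hence "(2 * of_nat k + 1 - 2 * of_nat (Suc i))\<^sup>2 = (2 * of_nat k + 1 - 2 * of_nat (Suc j) :: rat)\<^sup>2"
      using ij p by (simp add: ch_exponent_eq p_def)
    hence "(of_nat (2 * (k - Suc i) + 1))\<^sup>2 = (of_nat (2 * (k - Suc j) + 1) :: rat)\<^sup>2"
      using ij by (simp add: of_nat_diff algebra_simps)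
    hence "(2 * (k - Suc i) + 1)\<^sup>2 = (2 * (k - Suc j) + 1)\<^sup>2"
      by (metis of_nat_eq_iff of_nat_power)
    hence "2 * (k - Suc i) + 1 = 2 * (k - Suc j) + 1" by (rule power2_eq_imp_eq) auto
    thus "i = j" using ij by auto
  qed
  from vandermonde_nonzero[OF this] show ?thesis
    unfolding cusp_wronskian_def cusp_deriv_funpow_0 by (simp add: x_def)
qed

section \<open>Modularity of the quotient\<close>

lemma nome_plus_of_int: "nome (z + of_int n) = nome z"
proof -
  have "exp (2 * of_real pi * \<i> * of_int n) = 1"
    using exp_integer_2pi[of "of_int n"] by (simp add: mult_ac)
  thus ?thesis by (simp add: nome_def distrib_left exp_add)
qed

lemma nome_surj:
  assumes "norm q < 1" "q \<noteq> 0"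
  obtains z where "z \<in> \<H>" "nome z = q"
proof
  show "nome (Ln q / (2 * of_real pi * \<i>)) = q" using assms by (simp add: nome_def)
  hence "exp (- (2 * pi * Im (Ln q / (2 * of_real pi * \<i>)))) < exp 0"
    using norm_nome[of "Ln q / (2 * of_real pi * \<i>)"] assms by simp
  thus "Ln q / (2 * of_real pi * \<i>) \<in> \<H>"
    by (simp only: exp_less_cancel_iff upper_half_plane_def) (simp add: zero_less_mult_iff)
qed

text \<open>A coarse reduction theory that is enough for a compactness argument. After a translation
  the real part is at most 1/2 in modulus; if the imaginary part is then below 1/2, the squared
  modulus is at most 1/2 and inversion at least doubles the imaginary part. Finitely many steps
  therefore reach \<open>Im z \<ge> 1 / 2\<close>.\<close>

lemma upper_half_plane_reduction:
  assumes base: "\<And>z. 1 / 2 \<le> Im z \<Longrightarrow> P z"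
    and shift: "\<And>z n. z \<in> \<H> \<Longrightarrow> P (z + of_int n) \<Longrightarrow> P z"
    and inv: "\<And>z. z \<in> \<H> \<Longrightarrow> P (- 1 / z) \<Longrightarrow> P z"
    and z: "z \<in> \<H>"
  shows "P z"
proof -
  have "P z" if "(1 / 2) ^ n \<le> Im z" "z \<in> \<H>" for n z
    using that
  proof (induction n arbitrary: z)
    case 0
    thus ?case by (intro base) auto
  next
    case (Suc n)
    define w where "w = z + of_int (- round (Re z))"
    have w: "w \<in> \<H>" "Im w = Im z" using Suc.prems by (auto simp: w_def upper_half_plane_def)
    have Re: "\<bar>Re w\<bar> \<le> 1 / 2" using of_int_round_abs_le[of "Re z"] by (simp add: w_def abs_minus_commute)
    have "P w"
    proof (cases "1 / 2 \<le> Im w")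
      case False
      have pos: "Im w > 0" using w by (simp add: upper_half_plane_def)
      have "(Re w)\<^sup>2 \<le> (1 / 2)\<^sup>2" using Re by (metis abs_ge_zero power2_abs power_mono)
      moreover have "(Im w)\<^sup>2 \<le> (1 / 2)\<^sup>2" using False pos by (intro power_mono) auto
      ultimately have le: "(Re w)\<^sup>2 + (Im w)\<^sup>2 \<le> 1 / 2" by (simp add: power2_eq_square)
      have gt: "(Re w)\<^sup>2 + (Im w)\<^sup>2 > 0" using pos by (intro add_nonneg_pos) auto
      have "Im (- 1 / w) = Im w / ((Re w)\<^sup>2 + (Im w)\<^sup>2)" by (simp add: Im_divide)
      also have "\<dots> \<ge> Im w / (1 / 2)" using le gt pos by (intro divide_left_mono) auto
      finally have "2 * Im w \<le> Im (- 1 / w)" by simp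
      moreover have "(1 / 2) ^ n \<le> 2 * Im w" using Suc.prems w by simp
      ultimately have "P (- 1 / w)" by (intro Suc.IH minus_inverse_in_upper_half_plane w) linarith
      thus ?thesis by (rule inv[OF w(1)])
    qed (rule base)
    thus ?case unfolding w_def by (rule shift[OF Suc.prems(2)])
  qed
  moreover obtain n where "(1 / 2) ^ n < Im z"
    using real_arch_pow_inv[of "Im z" "1 / 2"] z by (auto simp: upper_half_plane_def)
  ultimately show ?thesis using z by (meson less_imp_le)
qed

text \<open>The orbit of every point meets the compact disc \<open>cball 0 (exp (- pi))\<close> in the variable \<open>q\<close>,
  so the maximum modulus is attained inside the unit disc.\<close>

lemma constant_if_norm_inversion_invariant:
  assumes \<phi>: "\<phi> holomorphic_on ball 0 1"
    and inv: "\<And>z. z \<in> \<H> \<Longrightarrow> norm (\<phi> (nome (- 1 / z))) = norm (\<phi> (nome z))"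
    and q: "q \<in> ball 0 1"
  shows "\<phi> q = \<phi> 0"
proof -
  \<comment> \<open>This radius is the modulus of the nome on the line \<open>Im z = 1 / 2\<close>,
    where the reduction stops.\<close>
  define r where "r = exp (- pi)"
  have r: "0 < r" "r < 1" by (simp_all add: r_def)
  have "continuous_on (cball 0 r) \<phi>"
    by (rule continuous_on_subset[OF holomorphic_on_imp_continuous_on[OF \<phi>]]) (use r in auto)
  hence "continuous_on (cball 0 r) (\<lambda>q. norm (\<phi> q))" by (intro continuous_intros)
  then obtain m where m: "m \<in> cball 0 r" "\<And>q. q \<in> cball 0 r \<Longrightarrow> norm (\<phi> q) \<le> norm (\<phi> m)"
    using continuous_attains_sup[of "cball 0 r" "\<lambda>q. norm (\<phi> q)"] r by auto
  have bound: "norm (\<phi> (nome z)) \<le> norm (\<phi> m)" if "z \<in> \<H>" for z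
    using that
  proof (rule upper_half_plane_reduction[of "\<lambda>z. norm (\<phi> (nome z)) \<le> norm (\<phi> m)", rotated -1])
    fix z assume "1 / 2 \<le> Im z"
    hence "nome z \<in> cball 0 r" by (simp add: norm_nome r_def)
    thus "norm (\<phi> (nome z)) \<le> norm (\<phi> m)" by (rule m)
  qed (use inv in \<open>simp_all add: nome_plus_of_int\<close>)
  have "norm (\<phi> q) \<le> norm (\<phi> m)" if "q \<in> ball 0 1" for q
  proof (cases "q = 0")
    case True
    thus ?thesis using r by (intro m) auto
  next
    case False
    have "norm q < 1" using that by simp
    then obtain z where "z \<in> \<H>" "nome z = q" using False by (rule nome_surj)
    thus ?thesis using bound by blast
  qed
  hence "\<phi> constant_on ball 0 1"
    using m(1) r by (intro maximum_modulus_principle[OF \<phi>, of "ball 0 1" m]) auto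
  thus ?thesis using q by (auto simp: constant_on_def)
qed

text \<open>\<open>dedekind_eta\<close> to the power \<open>2 * e\<close> has the weight and the
  leading power of \<open>q\<close> of the Wronskian, so \<open>\<phi>\<close> is holomorphic at 0
  with nonzero value and only picks up a constant under inversion. Once \<open>\<phi>\<close> is
  constant, the Wronskian is a nonzero multiple of a power of the eta product.\<close>

lemma cusp_wronskian_nonzero:
  assumes q: "q \<in> ball 0 1"
  shows "cusp_wronskian 0 k q \<noteq> 0"
proof -
  define e where "e = k * (k - 1)"
  define E where "E = euler_prod (\<lambda>n. n \<ge> 1)"
  define \<phi> where "\<phi> = (\<lambda>q. cusp_wronskian 0 k q / E q ^ (2 * e))"
  have E: "E q \<noteq> 0" if "q \<in> ball 0 1" for q
    using that euler_prod_nonzero[of q "\<lambda>n. n \<ge> 1"] by (simp add: E_def)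
  have \<phi>: "\<phi> holomorphic_on ball 0 1"
    unfolding \<phi>_def by (intro holomorphic_intros cusp_wronskian_holomorphic) (use E in \<open>auto simp: E_def intro!: euler_prod_holomorphic\<close>)
  have \<phi>0: "\<phi> 0 \<noteq> 0"
    using cusp_wronskian_0_nonzero E[of 0] by (simp add: \<phi>_def)
  have quot: "wronskian_det 0 k z = \<phi> (nome z) * dedekind_eta z ^ (2 * e)" if z: "z \<in> \<H>" for z
  proof -
    have "of_nat (2 * e) * (1 / 24) = (of_nat e / 12 :: rat)" by simp
    hence "qpow (1 / 24) z ^ (2 * e) = qpow (of_nat e / 12) z"
      unfolding qpow_def exp_of_nat_mult[symmetric] by (simp add: of_rat_divide mult_ac)
    moreover have "E (nome z) \<noteq> 0" using E norm_nome_less_1[OF z] by simp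
    ultimately show ?thesis
      by (simp add: wronskian_det_eq[OF z] \<phi>_def dedekind_eta_def power_mult_distrib E_def e_def)
  qed
  obtain D where D: "\<And>s z. s \<le> 1 \<Longrightarrow> z \<in> \<H> \<Longrightarrow> wronskian_det s k (- 1 / z) = z ^ (k * (k - 1) + 2 * s * k) * (D * wronskian_det s k z)"
    using wronskian_inversion[of k] by blast
  obtain c where c: "c \<noteq> 0" "\<And>z. z \<in> \<H> \<Longrightarrow> dedekind_eta (- 1 / z) ^ 2 = c * z * dedekind_eta z ^ 2"
    using eta_inversion by blast
  define K where "K = D / c ^ e"
  have K: "\<phi> (nome (- 1 / z)) = K * \<phi> (nome z)" if z: "z \<in> \<H>" for z
  proof -
    have nz: "z \<noteq> 0" "dedekind_eta z \<noteq> 0" using z by (auto simp: upper_half_plane_nonzero dedekind_eta_nonzero)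
    have "\<phi> (nome (- 1 / z)) * (c * z * dedekind_eta z ^ 2) ^ e = z ^ e * (D * (\<phi> (nome z) * (dedekind_eta z ^ 2) ^ e))"
      using quot[OF minus_inverse_in_upper_half_plane[OF z]] quot[OF z] D[of 0 z] z c(2)[OF z]
      by (simp add: power_mult e_def)
    thus ?thesis using nz c(1) by (simp add: K_def power_mult_distrib field_simps)
  qed
  \<comment> \<open>Inverting twice gives \<open>K * K = 1\<close>, provided \<open>\<phi>\<close>
    is nonzero at some point. Such a point is taken near \<open>q = 0\<close>, but different from 0,
    since 0 is not the nome of any point.\<close>
  have "norm K = 1"
  proof -
    have "isCont \<phi> 0"
      using holomorphic_on_imp_continuous_on[OF \<phi>] by (simp add: continuous_on_eq_continuous_at)
    hence "eventually (\<lambda>q. \<phi> q \<noteq> 0) (at 0)"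
      using \<phi>0 by (intro tendsto_imp_eventually_ne) (auto simp: isCont_def)
    hence "eventually (\<lambda>q. \<phi> q \<noteq> 0 \<and> q \<in> ball 0 1 \<and> q \<noteq> 0) (at 0)"
      using eventually_at_in_open'[of "ball 0 1" "0::complex"] eventually_neq_at_within[of 0 0]
      by (intro eventually_conj) auto
    then obtain q where q: "\<phi> q \<noteq> 0" "q \<in> ball 0 1" "q \<noteq> 0"
      using eventually_happens'[of "at (0::complex)"] by auto
    have "norm q < 1" using q(2) by simp
    then obtain z where z: "z \<in> \<H>" "nome z = q" using q(3) by (rule nome_surj)
    have "- 1 / (- 1 / z) = z" by simp
    hence "\<phi> q = K * (K * \<phi> q)"
      using K[OF minus_inverse_in_upper_half_plane[OF z(1)]] K[OF z(1)] z(2) by simp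
    hence "K * K = 1" using q(1) by simp
    hence "norm K * norm K = 1" by (metis norm_mult norm_one)
    hence "(norm K)\<^sup>2 = 1\<^sup>2" by (simp only: power2_eq_square mult_1)
    thus ?thesis by (rule power2_eq_imp_eq) auto
  qed
  hence "norm (\<phi> (nome (- 1 / z))) = norm (\<phi> (nome z))" if "z \<in> \<H>" for z
    unfolding K[OF that] by (simp add: norm_mult)
  hence "\<phi> q = \<phi> 0"
    by (rule constant_if_norm_inversion_invariant[OF \<phi> _ q])
  thus ?thesis using \<phi>0 by (auto simp: \<phi>_def)
qed

section \<open>From translations and inversion to the full modular group\<close>

lemma mobius_upper_half_plane:
  fixes a b c d :: int
  assumes det: "a * d - b * c = 1" and z: "z \<in> \<H>"
  shows "of_int c * z + of_int d \<noteq> 0" "(of_int a * z + of_int b) / (of_int c * z + of_int d) \<in> \<H>"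
proof -
  have pos: "Im z > 0" using z by (simp add: upper_half_plane_def)
  show nz: "of_int c * z + of_int d \<noteq> 0"
  proof
    assume *: "of_int c * z + of_int d = 0"
    hence "Im (of_int c * z + of_int d) = 0" by simp
    hence "c = 0" using pos by simp
    with * have "d = 0" by simp
    with \<open>c = 0\<close> det show False by simp
  qed
  have "real_of_int (a * d - b * c) = 1" using det by simp
  hence det': "real_of_int a * of_int d - of_int b * of_int c = 1" by simp
  have "Im ((of_int a * z + of_int b) * cnj (of_int c * z + of_int d)) = (real_of_int a * of_int d - of_int b * of_int c) * Im z"
    by (simp add: algebra_simps)
  hence "Im ((of_int a * z + of_int b) / (of_int c * z + of_int d)) = Im z / (norm (of_int c * z + of_int d))\<^sup>2"
    unfolding det' by (subst complex_div_cnj) simp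
  moreover have "\<dots> > 0" using pos nz by simp
  ultimately show "(of_int a * z + of_int b) / (of_int c * z + of_int d) \<in> \<H>"
    by (simp add: upper_half_plane_def)
qed

text \<open>The Euclidean algorithm on the first column: with \<open>a = n * c + r\<close> the
  matrix is a translation by \<open>n\<close>, an inversion, and a matrix with lower left entry
  \<open>r\<close>, smaller than \<open>c\<close> in modulus. The sign that arises in the automorphy
  factor disappears because the weight is even.\<close>

lemma modular_if_generators:
  assumes shift: "\<And>z n. z \<in> \<H> \<Longrightarrow> f (z + of_int n) = f z"
    and inv: "\<And>z. z \<in> \<H> \<Longrightarrow> f (- 1 / z) = z ^ (2 * k) * f z"
    and det: "a * d - b * c = (1 :: int)" and z: "z \<in> \<H>"
  shows "f ((of_int a * z + of_int b) / (of_int c * z + of_int d)) = (of_int c * z + of_int d) ^ (2 * k) * f z"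
  using det
proof (induction "nat \<bar>c\<bar>" arbitrary: a b c d rule: less_induct)
  case less
  show ?case
  proof (cases "c = 0")
    case True
    hence "a * d = 1" using less.prems by simp
    hence "a = 1 \<and> d = 1 \<or> a = - 1 \<and> d = - 1" by (rule zmult_eq_1_iff[THEN iffD1])
    \<comment> \<open>With \<open>a = d = - 1\<close> the map is the translation by
      \<open>- b\<close>.\<close>
    thus ?thesis
      using shift[OF z, of b] shift[OF z, of "- b"] True by (auto simp: power_mult)
  next
    case False
    define n where "n = a div c"
    define r where "r = a mod c"
    define b' where "b' = b - n * d"
    have a: "a = n * c + r" by (simp add: n_def r_def)
    have r: "nat \<bar>r\<bar> < nat \<bar>c\<bar>" using False abs_mod_less[of c a] by (simp add: r_def)
    have det': "(- c) * b' - (- d) * r = 1"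
      using less.prems by (simp add: a b'_def algebra_simps)
    have det'': "r * d - b' * c = 1" using det' by (simp add: algebra_simps)
    define w where "w = (of_int (- c) * z + of_int (- d)) / (of_int r * z + of_int b')"
    have w: "w \<in> \<H>" unfolding w_def by (rule mobius_upper_half_plane(2)[OF det' z])
    have nz1: "of_int r * z + of_int b' \<noteq> 0" by (rule mobius_upper_half_plane(1)[OF det' z])
    have nz2: "of_int c * z + of_int d \<noteq> 0" by (rule mobius_upper_half_plane(1)[OF less.prems z])
    have fw: "f w = (of_int r * z + of_int b') ^ (2 * k) * f z"
      unfolding w_def by (rule less.hyps[OF r det'])
    have w_eq: "w = - ((of_int c * z + of_int d) / (of_int r * z + of_int b'))"
      by (simp add: w_def divide_simps)
    have "(of_int a * z + of_int b) / (of_int c * z + of_int d) = - 1 / w + of_int n"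
    proof -
      have num: "of_int a * z + of_int b = (of_int r * z + of_int b') + of_int n * (of_int c * z + of_int d)"
        by (simp add: a b'_def algebra_simps)
      have "(X + of_int n * Y) / Y = - 1 / - (Y / X) + of_int n" if "X \<noteq> 0" "Y \<noteq> 0" for X Y :: complex
        using that by (simp add: add_divide_distrib)
      from this[OF nz1 nz2] show ?thesis unfolding w_eq num .
    qed
    hence "f ((of_int a * z + of_int b) / (of_int c * z + of_int d)) = w ^ (2 * k) * f w"
      using shift[OF minus_inverse_in_upper_half_plane[OF w], of n] inv[OF w] by simp
    also have "\<dots> = (w * (of_int r * z + of_int b')) ^ (2 * k) * f z"
      by (simp add: fw power_mult_distrib)
    also have "w * (of_int r * z + of_int b') = - (of_int c * z + of_int d)"
      using nz1 by (simp add: w_eq)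
    also have "(- (of_int c * z + of_int d)) ^ (2 * k) = (of_int c * z + of_int d) ^ (2 * k)"
      by (rule power_minus_even) simp
    finally show ?thesis .
  qed
qed

theorem theorem1p2:
  fixes k :: nat
  assumes "k \<ge> 2"
  shows "holomorphic_modular_form (2 * int k) (\<F> k)"
proof -
  \<comment> \<open>The normalising factors only contribute this constant; no property of them is needed,
    not even that the definite descriptions are well-defined.\<close>
  define C where "C = (if \<forall>w\<in>\<H>. wronskian_det 1 k w = 0 then 0 else beta k / alpha k)"
  \<comment> \<open>The fractional powers of \<open>q\<close> in the two Wronskians are equal and
    cancel. What is left is holomorphic on the whole disc, so its Taylor series at 0 is the required
    expansion at the cusp.\<close>
  define \<psi> where "\<psi> = (\<lambda>q. C * (cusp_wronskian 1 k q / cusp_wronskian 0 k q))"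
  have F: "\<F> k z = C * (wronskian_det 1 k z / wronskian_det 0 k z)" for z
    by (simp add: \<F>_def W'_def W_def C_def)
  have \<psi>: "\<psi> holomorphic_on ball 0 1"
    unfolding \<psi>_def by (intro holomorphic_intros cusp_wronskian_holomorphic) (use cusp_wronskian_nonzero in auto)
  have F_nome: "\<F> k z = \<psi> (nome z)" if "z \<in> \<H>" for z
    using that by (simp add: F \<psi>_def wronskian_det_eq)
  have W0: "wronskian_det 0 k z \<noteq> 0" if "z \<in> \<H>" for z
    using that cusp_wronskian_nonzero norm_nome_less_1 by (simp add: wronskian_det_eq)
  obtain D where D: "\<And>s z. s \<le> 1 \<Longrightarrow> z \<in> \<H> \<Longrightarrow> wronskian_det s k (- 1 / z) = z ^ (k * (k - 1) + 2 * s * k) * (D * wronskian_det s k z)"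
    using wronskian_inversion[of k] by blast
  have inv: "\<F> k (- 1 / z) = z ^ (2 * k) * \<F> k z" if z: "z \<in> \<H>" for z
  proof -
    \<comment> \<open>The first Wronskian vanishes nowhere, in particular not at
      \<open>- 1 / z\<close>, so the common multiplier can be cancelled; the exponents for
      \<open>s = 1\<close> and \<open>s = 0\<close> differ by \<open>2 * k\<close>.\<close>
    have "D \<noteq> 0" using D[OF _ z, of 0] W0[OF minus_inverse_in_upper_half_plane[OF z]] by auto
    moreover have "z \<noteq> 0" using z by (rule upper_half_plane_nonzero)
    ultimately show ?thesis using D[OF _ z, of 0] D[OF _ z, of 1] by (simp add: F power_add)
  qed
  have shift: "\<F> k (z + of_int n) = \<F> k z" if z: "z \<in> \<H>" for z n
  proof -
    have "z + of_int n \<in> \<H>" using z by (simp add: upper_half_plane_def)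
    thus ?thesis using z by (simp add: F_nome nome_plus_of_int)
  qed
  have "\<F> k holomorphic_on \<H>"
    by (rule holomorphic_transform[OF holomorphic_compose_nome[OF \<psi>]]) (simp add: F_nome)
  moreover have "\<exists>a. \<forall>z\<in>\<H>. (\<lambda>n. a n * qpow (of_nat n) z) sums \<F> k z"
  proof (intro exI ballI)
    fix z assume z: "z \<in> \<H>"
    show "(\<lambda>n. (deriv ^^ n) \<psi> 0 / fact n * qpow (of_nat n) z) sums \<F> k z"
      using holomorphic_power_series[OF \<psi>, of "nome z"] norm_nome_less_1[OF z]
      by (simp add: F_nome[OF z] qpow_of_nat)
  qed
  moreover have "\<F> k ((of_int a * z + of_int b) / (of_int c * z + of_int d)) = (of_int c * z + of_int d) powi (2 * int k) * \<F> k z"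
    if "a * d - b * c = 1" "z \<in> \<H>" for a b c d :: int and z
    using modular_if_generators[where f = "\<F> k" and k = k, OF shift inv that]
    by (metis of_nat_mult of_nat_numeral power_int_of_nat)
  ultimately show ?thesis unfolding holomorphic_modular_form_def by blast
qed

end
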